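(* Let $\mathscr{H}=\mathscr{H}_L\oplus\mathscr{H}_C\oplus\mathscr{H}_R$ be an orthogonal decomposition of a Hilbert space and, for $A\in\{L,C,R,LC,CR\}$, let $P_A$ be the orthogonal projection of $\mathscr{H}$ onto $\mathscr{H}_A$, where $\mathscr{H}_{LC}=\mathscr{H}_L\oplus\mathscr{H}_C$ and $\mathscr{H}_{CR}=\mathscr{H}_C\oplus\mathscr{H}_R$. A unitary operator $U$ on $\mathscr{H}$ admits a factorization $$U=(U_{LC}\oplus\mathbb{1}_{\mathscr{H}_R})(\mathbb{1}_{\mathscr{H}_L}\oplus U_{CR})$$ with $U_{LC}$ a unitary operator on $\mathscr{H}_{LC}$ and $U_{CR}$ a unitary operator on $\mathscr{H}_{CR}$ (an $\mathscr{H}_C$-overlapping factorization) if and only if $$P_RUP_L=0\quad\text{and}\quad \operatorname{rank}(P_{LC}UP_{CR})=\operatorname{rank}P_C .$$ Moreover, in this case the factorization is unique up to a unitary $U_C$ on $\mathscr{H}_C$: any other such factorization is given by $\hat U_{LC}=U_{LC}(\mathbb{1}_{\mathscr{H}_L}\oplus U_C)$ and $\hat U_{CR}=(U_C^\dagger\oplus\mathbb{1}_{\mathscr{H}_R})U_{CR}$ for some unitary $U_C$ on $\mathscr{H}_C$ (and every such pair is again an $\mathscr{H}_C$-overlapping factorization of $U$). Finally, if $\dim\mathscr{H}_L<\infty$ or $\dim\mathscr{H}_R<\infty$, the rank condition may be omitted, i.e. $P_RUP_L=0$ alone is equivalent to the existence of such a factorization.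
   Context: $\mathbb{1}_{\mathscr{K}}$ denotes the identity operator on a Hilbert space $\mathscr{K}$; direct sums of operators are taken with respect to the indicated orthogonal decompositions (e.g. $U_{LC}\oplus\mathbb{1}_{\mathscr{H}_R}$ acts as $U_{LC}$ on $\mathscr{H}_{LC}$ and as the identity on $\mathscr{H}_R$). *)

theory Defs
  imports "HOL-Analysis.Analysis" "HOL-Library.Equipollence"
begin

class complex_vector = real_vector +
  fixes scaleC :: "complex \<Rightarrow> 'a \<Rightarrow> 'a"
  assumes scaleC_add_right: "scaleC a (x + y) = scaleC a x + scaleC a y"
    and scaleC_add_left: "scaleC (a + b) x = scaleC a x + scaleC b x"
    and scaleC_scaleC: "scaleC a (scaleC b x) = scaleC (a * b) x"
    and scaleC_one: "scaleC 1 x = x"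
    and scaleR_scaleC: "scaleR r x = scaleC (complex_of_real r) x"

class complex_inner = complex_vector + real_normed_vector +
  fixes cinner :: "'a \<Rightarrow> 'a \<Rightarrow> complex"
  assumes cinner_commute: "cinner x y = cnj (cinner y x)"
    and cinner_add_left: "cinner (x + y) z = cinner x z + cinner y z"
    and cinner_scaleC_left: "cinner (scaleC r x) y = cnj r * cinner x y"
    and cinner_self_real: "Im (cinner x x) = 0"
    and cinner_self_nonneg: "0 \<le> Re (cinner x x)"
    and cinner_self_zero_iff: "cinner x x = 0 \<longleftrightarrow> x = 0"
    and norm_cinner: "norm x = sqrt (Re (cinner x x))"

class chilbert_space = complex_inner + complete_space

definition csubspace :: "'a::complex_vector set \<Rightarrow> bool" where
  "csubspace S \<longleftrightarrow> 0 \<in> S \<and> (\<forall>x\<in>S. \<forall>y\<in>S. x + y \<in> S) \<and> (\<forall>c. \<forall>x\<in>S. scaleC c x \<in> S)"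

definition closed_csubspace :: "'a::chilbert_space set \<Rightarrow> bool" where
  "closed_csubspace S \<longleftrightarrow> csubspace S \<and> closed S"

definition cspan :: "'a::complex_vector set \<Rightarrow> 'a set" where
  "cspan B = \<Inter>{T. csubspace T \<and> B \<subseteq> T}"

definition corthogonal :: "'a::chilbert_space set \<Rightarrow> 'a set \<Rightarrow> bool" where
  "corthogonal S T \<longleftrightarrow> (\<forall>x\<in>S. \<forall>y\<in>T. cinner x y = 0)"

definition osum :: "'a::chilbert_space set \<Rightarrow> 'a set \<Rightarrow> 'a set" where
  "osum S T = {x + y | x y. x \<in> S \<and> y \<in> T}"

definition proj :: "'a::chilbert_space set \<Rightarrow> 'a \<Rightarrow> 'a" where
  "proj S x = (THE y. y \<in> S \<and> (\<forall>z\<in>S. cinner (x - y) z = 0))"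

definition orth_decomp3 :: "'a::chilbert_space set \<Rightarrow> 'a set \<Rightarrow> 'a set \<Rightarrow> bool" where
  "orth_decomp3 L C R \<longleftrightarrow> closed_csubspace L \<and> closed_csubspace C \<and> closed_csubspace R \<and>
     corthogonal L C \<and> corthogonal L R \<and> corthogonal C R \<and> osum (osum L C) R = UNIV"

definition is_onb :: "'a::chilbert_space set \<Rightarrow> 'a set \<Rightarrow> bool" where
  "is_onb S B \<longleftrightarrow> B \<subseteq> S \<and> (\<forall>b\<in>B. cinner b b = 1) \<and>
     (\<forall>b\<in>B. \<forall>b'\<in>B. b \<noteq> b' \<longrightarrow> cinner b b' = 0) \<and> closure (cspan B) = S"

text \<open>Equality of ranks: the (Hilbert) dimensions of the (closures of the) ranges
  of T1 and T2 coincide, i.e. they have equipollent orthonormal bases.\<close>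
definition same_rank :: "('a::chilbert_space \<Rightarrow> 'a) \<Rightarrow> ('a \<Rightarrow> 'a) \<Rightarrow> bool" where
  "same_rank T1 T2 \<longleftrightarrow> (\<exists>B1 B2. is_onb (closure (range T1)) B1 \<and>
     is_onb (closure (range T2)) B2 \<and> B1 \<approx> B2)"

definition fin_dim :: "'a::complex_vector set \<Rightarrow> bool" where
  "fin_dim S \<longleftrightarrow> (\<exists>B. finite B \<and> S = cspan B)"

text \<open>f is a unitary operator on the subspace S (only its values on S matter):
  complex linear on S, inner-product preserving on S, and mapping S onto S.\<close>
definition unitary_on :: "'a::chilbert_space set \<Rightarrow> ('a \<Rightarrow> 'a) \<Rightarrow> bool" where
  "unitary_on S f \<longleftrightarrow>
     (\<forall>x\<in>S. \<forall>y\<in>S. f (x + y) = f x + f y) \<and> (\<forall>c. \<forall>x\<in>S. f (scaleC c x) = scaleC c (f x)) \<and>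
     (\<forall>x\<in>S. \<forall>y\<in>S. cinner (f x) (f y) = cinner x y) \<and> f ` S = S"

definition is_adjoint_on :: "'a::chilbert_space set \<Rightarrow> ('a \<Rightarrow> 'a) \<Rightarrow> ('a \<Rightarrow> 'a) \<Rightarrow> bool" where
  "is_adjoint_on S f g \<longleftrightarrow> g ` S \<subseteq> S \<and> (\<forall>x\<in>S. \<forall>y\<in>S. cinner (f x) y = cinner x (g y))"

definition overlap_fact ::
  "'a::chilbert_space set \<Rightarrow> 'a set \<Rightarrow> 'a set \<Rightarrow> ('a \<Rightarrow> 'a) \<Rightarrow> ('a \<Rightarrow> 'a) \<Rightarrow> ('a \<Rightarrow> 'a) \<Rightarrow> bool" where
  "overlap_fact L C R U ULC UCR \<longleftrightarrow>
     unitary_on (osum L C) ULC \<and> unitary_on (osum C R) UCR \<and>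
     U = (\<lambda>x. ULC (proj (osum L C) x) + proj R x) \<circ> (\<lambda>x. proj L x + UCR (proj (osum C R) x))"

end

theory Submission
  imports Defs
begin

text \<open>A factorization exists iff some unitary $V$ of $\mathscr{H}_{LC}$ agrees with $U$ on
  $\mathscr{H}_L$. Such a $V$ must map $\mathscr{H}_C$ onto
  $M = \mathscr{H}_{LC} \ominus U \mathscr{H}_L$, so it exists iff
  $U \mathscr{H}_L \subseteq \mathscr{H}_{LC}$ and $\dim M = \dim \mathscr{H}_C$; and $M$ is
  exactly the range of $P_{LC} U P_{CR}$. If $\mathscr{H}_L$ or $\mathscr{H}_R$ is
  finite-dimensional, $V$ comes instead from a Witt-type extension: an isometry
  defined on finitely many vectors of a space extends to a unitary of that space, by composing
  rank-one perturbations of the identity.\<close>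

subsection \<open>Inner products\<close>

text \<open>Cancelling \<open>L\<close> against \<open>U L\<close> in the identity of
  \<open>L\<close> plus \<open>C\<close> with \<open>U L\<close> plus \<open>M\<close> is legitimate
  only under finiteness; this is why the rank condition exists. Bilateral shift: let
  \<open>U e_n = e_(n+1)\<close>, \<open>C = {0}\<close>, \<open>L\<close> the closed span of the
  \<open>e_n\<close> with \<open>n >= 0\<close>, \<open>R\<close> that of the others. Then
  \<open>P_R U P_L = 0\<close>, but \<open>M\<close> is the line through \<open>e_0\<close>, so no
  factorization exists. Equality of Hilbert dimensions enters only as the existence of an isometry:
  a bijection of orthonormal bases preserves inner products and is extended by continuity. If
  \<open>R\<close> is the finite-dimensional summand, \<open>U\<close> restricted to
  \<open>L\<close> offers no finite set of vectors. The condition is then read backwards: the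
  inverse of \<open>U\<close> maps \<open>R\<close> into \<open>osum C R\<close>, and this
  restriction is the one extended. Correcting \<open>U\<close> by the extension gives an operator
  that fixes \<open>R\<close> and hence acts on \<open>osum L C\<close>.\<close>

lemma cinner_add_right:
  "cinner x (y + z) = cinner x y + cinner (x :: 'a::complex_inner) z"
  using cinner_commute[of x] cinner_add_left[of y z x]
  by (metis complex_cnj_add)

lemma cinner_scaleC_right:
  "cinner x (scaleC r y) = r * cinner (x :: 'a::complex_inner) y"
  using cinner_commute[of x] cinner_scaleC_left[of r y x]
  by (metis complex_cnj_cnj complex_cnj_mult)

lemma cinner_self: "cinner x x = complex_of_real ((norm (x :: 'a::complex_inner))\<^sup>2)"
  by (simp add: complex_eq_iff norm_cinner cinner_self_nonneg cinner_self_real)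

lemma cinner_eq_zero_commute: "cinner x y = 0 \<longleftrightarrow> cinner y (x :: 'a::complex_inner) = 0"
  by (metis cinner_commute complex_cnj_zero_iff)

lemma norm_scaleC: "norm (scaleC c x) = cmod c * norm (x :: 'a::complex_inner)"
proof -
  have "complex_of_real ((norm (scaleC c x))\<^sup>2) = cnj c * c * complex_of_real ((norm x)\<^sup>2)"
    unfolding cinner_self[symmetric] by (simp add: cinner_scaleC_left cinner_scaleC_right)
  also have "\<dots> = complex_of_real ((cmod c * norm x)\<^sup>2)"
    by (simp add: complex_norm_square[symmetric] power_mult_distrib mult.commute[of "cnj c"])
  finally have "(norm (scaleC c x))\<^sup>2 = (cmod c * norm x)\<^sup>2"
    using of_real_eq_iff by blast
  then show ?thesis by (simp add: power2_eq_iff_nonneg)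
qed

interpretation scaleC: bounded_bilinear "scaleC :: complex \<Rightarrow> 'a::complex_inner \<Rightarrow> 'a"
  by standard
    (auto simp: scaleC_add_left scaleC_add_right scaleR_scaleC scaleC_scaleC mult.commute
       scaleR_conv_of_real norm_scaleC intro: exI[of _ 1])

lemma scaleC_minus1: "scaleC (-1) x = - (x :: 'a::complex_inner)"
  by (simp add: scaleC.minus_left scaleC_one)

text \<open>Pythagoras for \<open>w\<close> minus its component along \<open>z\<close>.
  Nonnegativity of the left side yields Cauchy-Schwarz; the strict decrease for a nonzero component
  yields orthogonality of a nearest point.\<close>

lemma norm_diff_component_sq:
  fixes w z :: "'a::complex_inner"
  assumes "z \<noteq> 0"
  shows "(norm (w - scaleC (cinner z w / cinner z z) z))\<^sup>2
    = (norm w)\<^sup>2 - (cmod (cinner z w))\<^sup>2 / (norm z)\<^sup>2"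
proof -
  define t where "t = cinner z w / cinner z z"
  define u where "u = w + scaleC (- t) z"
  have zz: "cinner z z \<noteq> 0" using assms by (simp add: cinner_self_zero_iff)
  have zu: "cinner z u = 0"
    using zz by (simp add: u_def t_def cinner_add_right cinner_scaleC_right)
  then have "cinner u u = cinner w u"
    using cinner_add_left[of w "scaleC (- t) z" u]
    by (simp add: u_def[symmetric] cinner_scaleC_left)
  also have "\<dots> = cinner w w - t * cnj (cinner z w)"
    by (simp add: u_def cinner_add_right cinner_scaleC_right cinner_commute[of w z])
  also have "t * cnj (cinner z w) = complex_of_real ((cmod (cinner z w))\<^sup>2 / (norm z)\<^sup>2)"
    unfolding t_def cinner_self by (simp add: complex_norm_square[symmetric])
  finally have "complex_of_real ((norm u)\<^sup>2)
      = complex_of_real ((norm w)\<^sup>2 - (cmod (cinner z w))\<^sup>2 / (norm z)\<^sup>2)"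
    unfolding cinner_self by simp
  then have "(norm u)\<^sup>2 = (norm w)\<^sup>2 - (cmod (cinner z w))\<^sup>2 / (norm z)\<^sup>2"
    using of_real_eq_iff by blast
  then show ?thesis by (simp add: u_def t_def scaleC.minus_left)
qed

lemma norm_cinner_le: "cmod (cinner x y) \<le> norm x * norm (y :: 'a::complex_inner)"
proof (cases "x = 0")
  case True
  have "cinner 0 y = 0"
    using cinner_add_left[of 0 0 y] by simp
  then show ?thesis using True by simp
next
  case False
  have "0 \<le> (norm y)\<^sup>2 - (cmod (cinner x y))\<^sup>2 / (norm x)\<^sup>2"
    using norm_diff_component_sq[OF False, of y] by (metis zero_le_power2)
  then have "(cmod (cinner x y))\<^sup>2 \<le> (norm x * norm y)\<^sup>2"
    using False by (simp add: field_simps power_mult_distrib)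
  then show ?thesis by (rule power2_le_imp_le) simp
qed

interpretation cinner: bounded_bilinear "cinner :: 'a::complex_inner \<Rightarrow> 'a \<Rightarrow> complex"
  by standard
    (auto simp: cinner_add_left cinner_add_right scaleR_scaleC cinner_scaleC_left
       cinner_scaleC_right scaleR_conv_of_real norm_cinner_le intro: exI[of _ 1])

lemma parallelogram:
  fixes a b :: "'a::complex_inner"
  shows "(norm (a + b))\<^sup>2 + (norm (a - b))\<^sup>2 = 2 * (norm a)\<^sup>2 + 2 * (norm b)\<^sup>2"
proof -
  have "complex_of_real ((norm (a + b))\<^sup>2 + (norm (a - b))\<^sup>2)
      = complex_of_real (2 * (norm a)\<^sup>2 + 2 * (norm b)\<^sup>2)"
    unfolding of_real_add of_real_mult cinner_self[symmetric]
    by (simp add: cinner.add_left cinner.add_right cinner.diff_left cinner.diff_right)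
  then show ?thesis using of_real_eq_iff by blast
qed

subsection \<open>Subspaces and projections\<close>

lemma csubspaceD:
  assumes "csubspace S"
  shows csubspace_0: "0 \<in> S"
    and csubspace_add: "x \<in> S \<Longrightarrow> y \<in> S \<Longrightarrow> x + y \<in> S"
    and csubspace_scaleC: "x \<in> S \<Longrightarrow> scaleC c x \<in> S"
  using assms by (auto simp: csubspace_def)

lemma csubspace_diff:
  fixes S :: "'a::complex_inner set"
  assumes "csubspace S" "x \<in> S" "y \<in> S"
  shows "x - y \<in> S"
  using csubspace_add[OF assms(1,2) csubspace_scaleC[OF assms(1,3), of "-1"]]
  by (simp add: scaleC_minus1)

lemma csubspace_UNIV: "csubspace UNIV"
  by (simp add: csubspace_def)

lemma csubspace_cspan: "csubspace (cspan B)"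
  by (auto simp: cspan_def csubspace_def)

lemma cspan_superset: "B \<subseteq> cspan B"
  by (auto simp: cspan_def)

lemma cspan_minimal: "csubspace T \<Longrightarrow> B \<subseteq> T \<Longrightarrow> cspan B \<subseteq> T"
  by (auto simp: cspan_def)

lemma csubspace_closure:
  fixes S :: "'a::chilbert_space set"
  assumes "csubspace S"
  shows "csubspace (closure S)"
  unfolding csubspace_def
proof (intro conjI ballI allI)
  show "0 \<in> closure S"
    using csubspace_0[OF assms] closure_subset by blast
next
  fix x y assume "x \<in> closure S" "y \<in> closure S"
  then obtain f g where "\<And>n. f n \<in> S" "f \<longlonglongrightarrow> x" "\<And>n. g n \<in> S" "g \<longlonglongrightarrow> y"
    by (auto simp: closure_sequential)
  then show "x + y \<in> closure S"
    unfolding closure_sequential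
    by (intro exI[of _ "\<lambda>n. f n + g n"]) (auto intro: tendsto_add csubspace_add[OF assms])
next
  fix c x assume "x \<in> closure S"
  then obtain f where "\<And>n. f n \<in> S" "f \<longlonglongrightarrow> x"
    by (auto simp: closure_sequential)
  then show "scaleC c x \<in> closure S"
    unfolding closure_sequential
    by (intro exI[of _ "\<lambda>n. scaleC c (f n)"])
      (auto intro: scaleC.tendsto csubspace_scaleC[OF assms])
qed

section \<open>Orthogonal complements and the projection theorem\<close>

definition orth_compl :: "'a::chilbert_space set \<Rightarrow> 'a set" where
  "orth_compl S = {x. \<forall>y\<in>S. cinner x y = 0}"

lemma closed_csubspace_orth_compl: "closed_csubspace (orth_compl S)"
proof -
  have "closed {x. cinner x y = 0}" for y :: 'a
    by (intro closed_Collect_eq continuous_intros cinner.continuous_on)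
  then have "closed (\<Inter>y\<in>S. {x. cinner x y = 0})" by blast
  moreover have "orth_compl S = (\<Inter>y\<in>S. {x. cinner x y = 0})"
    by (auto simp: orth_compl_def)
  ultimately show ?thesis
    by (auto simp: closed_csubspace_def csubspace_def orth_compl_def cinner.zero_left
        cinner_add_left cinner_scaleC_left)
qed

lemma closed_csubspace_Int:
  "closed_csubspace S \<Longrightarrow> closed_csubspace T \<Longrightarrow> closed_csubspace (S \<inter> T)"
  by (auto simp: closed_csubspace_def csubspace_def)

lemma orth_compl_antimono: "S \<subseteq> T \<Longrightarrow> orth_compl T \<subseteq> orth_compl S"
  by (auto simp: orth_compl_def)

lemma orth_compl_double: "S \<subseteq> orth_compl (orth_compl S)"
  using cinner_eq_zero_commute by (auto simp: orth_compl_def)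

text \<open>The double complement of \<open>B\<close> is a closed subspace containing
  \<open>B\<close>, hence contains its closed span; so whatever is orthogonal to \<open>B\<close> is
  orthogonal to the closed span.\<close>

lemma orth_compl_closure_cspan: "orth_compl (closure (cspan B)) = orth_compl B"
proof
  have "B \<subseteq> closure (cspan B)"
    using cspan_superset closure_subset by blast
  then show "orth_compl (closure (cspan B)) \<subseteq> orth_compl B"
    by (rule orth_compl_antimono)
next
  have "closed_csubspace (orth_compl (orth_compl B))"
    by (rule closed_csubspace_orth_compl)
  then have "closure (cspan B) \<subseteq> orth_compl (orth_compl B)"
    by (intro closure_minimal cspan_minimal orth_compl_double) (auto simp: closed_csubspace_def)
  then show "orth_compl B \<subseteq> orth_compl (closure (cspan B))"
    using cinner_eq_zero_commute by (fastforce simp: orth_compl_def)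
qed

text \<open>A sequence in \<open>S\<close> minimizing the squared distance to \<open>x\<close> is
  Cauchy by the parallelogram law; its limit is a nearest point, and the residual at a nearest point
  is orthogonal to \<open>S\<close>.\<close>

theorem projection_exists:
  fixes S :: "'a::chilbert_space set"
  assumes "closed_csubspace S"
  shows "\<exists>y\<in>S. x - y \<in> orth_compl S"
proof -
  have sub: "csubspace S" and "closed S"
    using assms by (auto simp: closed_csubspace_def)
  define D where "D = Inf ((\<lambda>y. (norm (x - y))\<^sup>2) ` S)"
  have bdd: "bdd_below ((\<lambda>y. (norm (x - y))\<^sup>2) ` S)"
    by (rule bdd_belowI[of _ 0]) auto
  have D_le: "D \<le> (norm (x - y))\<^sup>2" if "y \<in> S" for y
    unfolding D_def by (rule cInf_lower[OF _ bdd]) (use that in auto)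
  have "\<exists>y\<in>S. (norm (x - y))\<^sup>2 < D + 1 / real (Suc n)" for n
  proof -
    have "D < D + 1 / real (Suc n)" by simp
    then show ?thesis
      unfolding D_def using cInf_less_iff[OF _ bdd] csubspace_0[OF sub] by blast
  qed
  then obtain f where fS: "\<And>n. f n \<in> S"
    and f: "\<And>n. (norm (x - f n))\<^sup>2 < D + 1 / real (Suc n)" by metis
  have dist_f: "(norm (f m - f n))\<^sup>2 \<le> 2 / real (Suc m) + 2 / real (Suc n)" for m n
  proof -
    \<comment> \<open>The midpoint lies in \<open>S\<close>, so its squared distance to
      \<open>x\<close> is at least \<open>D\<close>; the parallelogram law then bounds the squared
      gap by \<open>2 (D + 1/(m+1)) + 2 (D + 1/(n+1)) - 4 D\<close>.\<close>
    define p where "p = scaleC (1/2) (f m + f n)"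
    have "p \<in> S" unfolding p_def using fS sub by (intro csubspace_scaleC csubspace_add)
    have "(x - f m) + (x - f n) = scaleC 2 (x - p)"
    proof -
      have "scaleC 2 x = x + x"
        using scaleC_add_left[of 1 1 x] by (simp add: scaleC_one)
      then show ?thesis
        by (simp add: p_def scaleC.diff_right scaleC_scaleC scaleC_one)
    qed
    then have "(norm ((x - f m) + (x - f n)))\<^sup>2 = 4 * (norm (x - p))\<^sup>2"
      by (simp add: norm_scaleC power_mult_distrib)
    moreover have "(norm ((x - f m) - (x - f n)))\<^sup>2 = (norm (f m - f n))\<^sup>2"
      by (simp add: norm_minus_commute)
    ultimately show ?thesis
      using parallelogram[of "x - f m" "x - f n"] D_le[OF \<open>p \<in> S\<close>] f[of m] f[of n]
      by simp
  qed
  have "Cauchy f"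
  proof (rule metric_CauchyI)
    fix e :: real assume "0 < e"
    obtain N where N: "4 / real (Suc N) < e\<^sup>2"
    proof -
      obtain N where "1 / real (Suc N) < e\<^sup>2 / 4"
        using nat_approx_posE[of "e\<^sup>2 / 4"] \<open>0 < e\<close> by auto
      then show ?thesis using that by (simp add: field_simps)
    qed
    have "dist (f m) (f n) < e" if "N \<le> m" "N \<le> n" for m n
    proof -
      have "2 / real (Suc m) \<le> 2 / real (Suc N)" "2 / real (Suc n) \<le> 2 / real (Suc N)"
        using that by (auto intro!: divide_left_mono)
      then have "(dist (f m) (f n))\<^sup>2 < e\<^sup>2"
        using dist_f[of m n] N by (simp add: dist_norm)
      then show ?thesis using \<open>0 < e\<close> by (simp add: power2_less_imp_less)
    qed
    then show "\<exists>M. \<forall>m\<ge>M. \<forall>n\<ge>M. dist (f m) (f n) < e" by blast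
  qed
  then obtain y where y: "f \<longlonglongrightarrow> y"
    using Cauchy_convergent convergent_def by blast
  have "y \<in> S"
    using closed_sequentially[OF \<open>closed S\<close>] fS y by blast
  have norm_y: "(norm (x - y))\<^sup>2 \<le> D"
  proof (rule LIMSEQ_le)
    show "(\<lambda>n. (norm (x - f n))\<^sup>2) \<longlonglongrightarrow> (norm (x - y))\<^sup>2"
      by (intro tendsto_intros y)
    show "(\<lambda>n. D + 1 / real (Suc n)) \<longlonglongrightarrow> D"
      using tendsto_add[OF tendsto_const[of D] LIMSEQ_Suc[OF lim_1_over_n]] by simp
    show "\<exists>N. \<forall>n\<ge>N. (norm (x - f n))\<^sup>2 \<le> D + 1 / real (Suc n)"
      using f less_imp_le by blast
  qed
  have "cinner (x - y) z = 0" if "z \<in> S" for z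
  proof (cases "z = 0")
    case False
    \<comment> \<open>With this coefficient \<open>scaleC t z\<close> is the component of
      \<open>x - y\<close> along \<open>z\<close>; were it nonzero, \<open>y + scaleC t z\<close>
      would be a point of \<open>S\<close> at squared distance below \<open>D\<close>.\<close>
    define t where "t = cinner z (x - y) / cinner z z"
    have "y + scaleC t z \<in> S"
      using \<open>y \<in> S\<close> that sub by (intro csubspace_add csubspace_scaleC)
    then have "D \<le> (norm (x - y - scaleC t z))\<^sup>2"
      using D_le by (metis diff_diff_eq)
    then have "(cmod (cinner z (x - y)))\<^sup>2 / (norm z)\<^sup>2 \<le> 0"
      using norm_y norm_diff_component_sq[OF False, of "x - y"] unfolding t_def by linarith
    then have "cinner z (x - y) = 0"
      using False by (simp add: divide_le_0_iff)
    then show ?thesis using cinner_eq_zero_commute by blast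
  qed (simp add: cinner.zero_right)
  then show ?thesis using \<open>y \<in> S\<close> by (auto simp: orth_compl_def)
qed

lemma proj_eqI:
  assumes "csubspace S" "y \<in> S" "x - y \<in> orth_compl S"
  shows "proj S x = y"
  unfolding proj_def
proof (rule the_equality)
  show "y \<in> S \<and> (\<forall>z\<in>S. cinner (x - y) z = 0)"
    using assms by (auto simp: orth_compl_def)
next
  fix y' assume y': "y' \<in> S \<and> (\<forall>z\<in>S. cinner (x - y') z = 0)"
  have "cinner (x - y) (y' - y) = 0" "cinner (x - y') (y' - y) = 0"
    using assms y' csubspace_diff[of S y' y] by (auto simp: orth_compl_def)
  then have "cinner (y' - y) (y' - y) = 0"
    by (simp add: cinner.diff_left)
  then show "y' = y" by (simp add: cinner_self_zero_iff)
qed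

lemma
  assumes "closed_csubspace S"
  shows proj_in: "proj S x \<in> S"
    and proj_orth: "x - proj S x \<in> orth_compl S"
proof -
  have sub: "csubspace S" using assms by (simp add: closed_csubspace_def)
  obtain y where "y \<in> S" "x - y \<in> orth_compl S"
    using projection_exists[OF assms] by blast
  then show "proj S x \<in> S" "x - proj S x \<in> orth_compl S"
    using proj_eqI[OF sub] by auto
qed

lemma
  assumes "closed_csubspace S"
  shows proj_add: "proj S (x + y) = proj S x + proj S y"
    and proj_scaleC: "proj S (scaleC c x) = scaleC c (proj S x)"
    and proj_id: "x \<in> S \<Longrightarrow> proj S x = x"
    and proj_orth_compl: "x \<in> orth_compl S \<Longrightarrow> proj S x = 0"
proof -
  have sub: "csubspace S" and perp: "csubspace (orth_compl S)"
    using assms closed_csubspace_orth_compl[of S] by (auto simp: closed_csubspace_def)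
  note P = proj_in[OF assms] proj_orth[OF assms]
  show "proj S (x + y) = proj S x + proj S y"
    using csubspace_add[OF perp P(2)[of x] P(2)[of y]]
    by (intro proj_eqI sub csubspace_add P) (simp add: algebra_simps)
  show "proj S (scaleC c x) = scaleC c (proj S x)"
    using csubspace_scaleC[OF perp P(2)[of x], of c]
    by (intro proj_eqI sub csubspace_scaleC P) (simp add: scaleC.diff_right)
  show "x \<in> S \<Longrightarrow> proj S x = x"
    by (intro proj_eqI sub) (use csubspace_0[OF perp] in auto)
  show "x \<in> orth_compl S \<Longrightarrow> proj S x = 0"
    by (intro proj_eqI sub csubspace_0) auto
qed

subsection \<open>Isometries between subspaces\<close>

text \<open>\<open>unitary_on\<close> with separate source and target, since \<open>C\<close> must
  be carried onto a different subspace. As there, nothing is said about values outside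
  \<open>S\<close>.\<close>

definition isometry_onto :: "'a::chilbert_space set \<Rightarrow> 'a set \<Rightarrow> ('a \<Rightarrow> 'a) \<Rightarrow> bool" where
  "isometry_onto S T f \<longleftrightarrow>
     (\<forall>x\<in>S. \<forall>y\<in>S. f (x + y) = f x + f y) \<and> (\<forall>c. \<forall>x\<in>S. f (scaleC c x) = scaleC c (f x)) \<and>
     (\<forall>x\<in>S. \<forall>y\<in>S. cinner (f x) (f y) = cinner x y) \<and> f ` S = T"

lemma unitary_on_iff: "unitary_on S f \<longleftrightarrow> isometry_onto S S f"
  by (simp add: unitary_on_def isometry_onto_def)

lemma isometry_ontoD:
  assumes "isometry_onto S T f"
  shows isometry_onto_add: "x \<in> S \<Longrightarrow> y \<in> S \<Longrightarrow> f (x + y) = f x + f y"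
    and isometry_onto_scaleC: "x \<in> S \<Longrightarrow> f (scaleC c x) = scaleC c (f x)"
    and isometry_onto_cinner: "x \<in> S \<Longrightarrow> y \<in> S \<Longrightarrow> cinner (f x) (f y) = cinner x y"
    and isometry_onto_image: "f ` S = T"
    and isometry_onto_in: "x \<in> S \<Longrightarrow> f x \<in> T"
  using assms by (auto simp: isometry_onto_def)

lemma isometry_onto_zero:
  assumes "isometry_onto S T f" "csubspace S"
  shows "f 0 = 0"
  using isometry_onto_scaleC[OF assms(1) csubspace_0[OF assms(2)], of 0]
  by (simp add: scaleC.zero_left)

text \<open>Expanding the squared norm uses only the four inner products, so no additivity of a map
  \<open>x\<close> to \<open>x'\<close> is presupposed. It therefore applies to pairs in a relation
  not yet known to be a function.\<close>

lemma cinner_diff_self_eq: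
  fixes x y :: "'a::complex_inner" and x' y' :: "'b::complex_inner"
  assumes "cinner x x = cinner x' x'" "cinner x y = cinner x' y'"
    and "cinner y x = cinner y' x'" "cinner y y = cinner y' y'"
  shows "norm (x - y) = norm (x' - y')"
proof -
  have "cinner (x - y) (x - y) = cinner (x' - y') (x' - y')"
    using assms by (simp add: cinner.diff_left cinner.diff_right)
  then have "(norm (x - y))\<^sup>2 = (norm (x' - y'))\<^sup>2"
    unfolding cinner_self using of_real_eq_iff by blast
  then show ?thesis by (simp add: power2_eq_iff_nonneg)
qed

lemma isometry_onto_inj_on:
  assumes "isometry_onto S T f"
  shows "inj_on f S"
proof (rule inj_onI)
  fix x y assume "x \<in> S" "y \<in> S" "f x = f y"
  then have "norm (x - y) = norm (f x - f y)"
    by (intro cinner_diff_self_eq) (blast intro: isometry_onto_cinner[OF assms, symmetric])+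
  then show "x = y" using \<open>f x = f y\<close> by simp
qed

lemma isometry_onto_id: "isometry_onto S S (\<lambda>x. x)"
  by (simp add: isometry_onto_def)

lemma isometry_onto_compose:
  assumes "isometry_onto S T f" "isometry_onto T W g"
  shows "isometry_onto S W (\<lambda>x. g (f x))"
proof -
  have "(\<lambda>x. g (f x)) ` S = W"
    unfolding image_image[of g f S, symmetric] using assms by (simp add: isometry_onto_def)
  then show ?thesis
    using isometry_ontoD[OF assms(1)] isometry_ontoD[OF assms(2)] by (simp add: isometry_onto_def)
qed

lemma isometry_onto_cong:
  assumes "isometry_onto S T f" "csubspace S" "\<And>x. x \<in> S \<Longrightarrow> g x = f x"
  shows "isometry_onto S T g"
  using assms csubspaceD[OF assms(2)] by (auto simp: isometry_onto_def)

lemma isometry_onto_subset: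
  assumes "isometry_onto S T f" "A \<subseteq> S"
  shows "isometry_onto A (f ` A) f"
  using assms by (auto simp: isometry_onto_def subset_eq)

lemma isometry_onto_inv_into:
  assumes f: "isometry_onto S T f" and S: "csubspace S"
  shows "isometry_onto T S (inv_into S f)"
proof -
  let ?g = "inv_into S f"
  note inj = isometry_onto_inj_on[OF f]
  have g: "?g (f x) = x" if "x \<in> S" for x
    using inj that by (rule inv_into_f_f)
  have "?g (f x + f y) = x + y" if "x \<in> S" "y \<in> S" for x y
    using g[OF csubspace_add[OF S that]] isometry_onto_add[OF f that] by simp
  moreover have "?g (scaleC c (f x)) = scaleC c x" if "x \<in> S" for c x
    using g[OF csubspace_scaleC[OF S that]] isometry_onto_scaleC[OF f that] by simp
  moreover have "?g ` T = S"
    using g isometry_onto_image[OF f] by force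
  ultimately show ?thesis
    unfolding isometry_onto_def isometry_onto_image[OF f, symmetric]
    by (auto simp: g isometry_onto_cinner[OF f])
qed

text \<open>Preservation of inner products gives \<open>f x\<close> orthogonal to \<open>T\<close>
  exactly when \<open>x\<close> is orthogonal to \<open>S\<close>, and surjectivity on the whole
  space puts every vector in the range. Used to restrict an operator fixing \<open>L\<close> to
  \<open>osum C R\<close>, or one fixing \<open>R\<close> to \<open>osum L C\<close>.\<close>

lemma isometry_onto_orth_compl:
  assumes f: "isometry_onto UNIV UNIV f" and "f ` S = T"
  shows "isometry_onto (orth_compl S) (orth_compl T) f"
proof -
  have "f x \<in> orth_compl T \<longleftrightarrow> x \<in> orth_compl S" for x
    unfolding assms(2)[symmetric] by (simp add: orth_compl_def isometry_onto_cinner[OF f])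
  then have "f ` orth_compl S = orth_compl T \<inter> range f" by blast
  then have "f ` orth_compl S = orth_compl T"
    using isometry_onto_image[OF f] by simp
  then show ?thesis
    using isometry_onto_subset[OF f, of "orth_compl S"] by simp
qed

section \<open>Orthogonal direct sums of isometries\<close>

lemma corthogonal_imp:
  assumes "corthogonal S T"
  shows "S \<subseteq> orth_compl T" "T \<subseteq> orth_compl S"
  using assms cinner_eq_zero_commute by (auto simp: corthogonal_def orth_compl_def)

lemma
  assumes "closed_csubspace S" "closed_csubspace T" "corthogonal S T" "x \<in> S" "y \<in> T"
  shows proj_osum_left: "proj S (x + y) = x"
    and proj_osum_right: "proj T (x + y) = y"
  using assms corthogonal_imp[OF assms(3)]
  by (auto simp: proj_add proj_id proj_orth_compl subset_eq)

lemma isometry_onto_osum: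
  assumes S: "closed_csubspace S" "closed_csubspace S'" "corthogonal S S'"
    and T: "corthogonal T T'"
    and f: "isometry_onto S T f" and g: "isometry_onto S' T' g"
  shows "isometry_onto (osum S S') (osum T T') (\<lambda>x. f (proj S x) + g (proj S' x))"
    (is "isometry_onto _ _ ?h")
proof -
  note in1 = proj_in[OF S(1)] and in2 = proj_in[OF S(2)]
  have "?h ` osum S S' = osum T T'"
  proof
    show "?h ` osum S S' \<subseteq> osum T T'"
      using isometry_onto_in[OF f in1] isometry_onto_in[OF g in2] by (auto simp: osum_def)
    show "osum T T' \<subseteq> ?h ` osum S S'"
    proof
      fix y assume "y \<in> osum T T'"
      then obtain s s' where s: "s \<in> S" "s' \<in> S'" and y: "y = f s + g s'"
        using isometry_onto_image[OF f] isometry_onto_image[OF g] by (auto simp: osum_def)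
      then have "y = ?h (s + s')"
        by (simp add: proj_osum_left[OF S] proj_osum_right[OF S])
      then show "y \<in> ?h ` osum S S'"
        using s by (auto simp: osum_def)
    qed
  qed
  moreover have "cinner (?h x) (?h y) = cinner x y"
    if "x \<in> osum S S'" "y \<in> osum S S'" for x y
  proof -
    obtain a a' b b' where ab: "a \<in> S" "b \<in> S" "a' \<in> S'" "b' \<in> S'"
      and xy: "x = a + a'" "y = b + b'"
      using \<open>x \<in> _\<close> \<open>y \<in> _\<close> by (auto simp: osum_def)
    have "cinner a b' = 0" "cinner a' b = 0"
      using S(3) ab cinner_eq_zero_commute[of a' b] by (auto simp: corthogonal_def)
    moreover have "cinner (f a) (g b') = 0" "cinner (g a') (f b) = 0"
      using T ab isometry_onto_in[OF f] isometry_onto_in[OF g]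
        cinner_eq_zero_commute[of "g a'" "f b"] by (auto simp: corthogonal_def)
    ultimately show ?thesis
      using ab
      by (simp add: xy proj_osum_left[OF S] proj_osum_right[OF S] cinner.add_left cinner.add_right
          isometry_onto_cinner[OF f] isometry_onto_cinner[OF g])
  qed
  ultimately show ?thesis
    by (simp add: isometry_onto_def proj_add proj_scaleC S in1 in2 isometry_onto_add[OF f]
        isometry_onto_add[OF g] isometry_onto_scaleC[OF f] isometry_onto_scaleC[OF g]
        scaleC_add_right)
qed

subsection \<open>Orthonormal bases\<close>

text \<open>Density of the span follows from totality: for \<open>x\<close> in \<open>S\<close>, the
  residual of its projection onto the closed span of \<open>B\<close> stays in \<open>S\<close> and
  is orthogonal to \<open>B\<close>, hence is 0.\<close>

lemma is_onbI:
  assumes S: "closed_csubspace S" and "B \<subseteq> S" "\<And>b. b \<in> B \<Longrightarrow> cinner b b = 1"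
    and "\<And>b b'. b \<in> B \<Longrightarrow> b' \<in> B \<Longrightarrow> b \<noteq> b' \<Longrightarrow> cinner b b' = 0"
    and zero: "\<And>x. x \<in> S \<Longrightarrow> x \<in> orth_compl B \<Longrightarrow> x = 0"
  shows "is_onb S B"
proof -
  let ?T = "closure (cspan B)"
  have T: "closed_csubspace ?T"
    by (simp add: closed_csubspace_def csubspace_closure csubspace_cspan)
  have "?T \<subseteq> S"
    using S \<open>B \<subseteq> S\<close> by (intro closure_minimal cspan_minimal) (auto simp: closed_csubspace_def)
  moreover have "S \<subseteq> ?T"
  proof
    fix x assume "x \<in> S"
    have "x - proj ?T x \<in> S"
      using S \<open>x \<in> S\<close> proj_in[OF T, of x] \<open>?T \<subseteq> S\<close>
      by (auto simp: closed_csubspace_def intro!: csubspace_diff)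
    then have "x - proj ?T x = 0"
      using zero proj_orth[OF T, of x] orth_compl_closure_cspan by blast
    then show "x \<in> ?T" using proj_in[OF T, of x] by simp
  qed
  ultimately show ?thesis using assms by (auto simp: is_onb_def)
qed

lemma onb_orth_compl_zero:
  assumes "is_onb S B" "x \<in> S" "x \<in> orth_compl B"
  shows "x = 0"
proof -
  have "x \<in> orth_compl S"
    using assms orth_compl_closure_cspan[of B] by (simp add: is_onb_def)
  then show ?thesis
    using assms(2) cinner_self_zero_iff by (auto simp: orth_compl_def)
qed

text \<open>Zorn's lemma on the orthonormal subsets of \<open>S\<close>: a nonzero vector of
  \<open>S\<close> orthogonal to a maximal one could be normalized and added to it.\<close>

theorem onb_exists:
  assumes S: "closed_csubspace S"
  shows "\<exists>B. is_onb S B"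
proof -
  define F where "F = {B. B \<subseteq> S \<and> (\<forall>b\<in>B. cinner b b = 1) \<and>
    (\<forall>b\<in>B. \<forall>b'\<in>B. b \<noteq> b' \<longrightarrow> cinner b b' = 0)}"
  have "\<exists>M\<in>F. \<forall>X\<in>F. M \<subseteq> X \<longrightarrow> X = M"
  proof (rule subset_Zorn_nonempty)
    show "F \<noteq> {}" by (auto simp: F_def)
  next
    fix \<C> assume chain: "subset.chain F \<C>"
    have "cinner b b' = 0" if b: "b \<in> X" "X \<in> \<C>" "b' \<in> Y" "Y \<in> \<C>" "b \<noteq> b'" for b b' X Y
    proof -
      have "X \<subseteq> Y \<or> Y \<subseteq> X" "X \<in> F" "Y \<in> F"
        using chain b unfolding subset.chain_def by auto
      then show ?thesis using b by (auto simp: F_def)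
    qed
    moreover have "X \<subseteq> S" "\<forall>b\<in>X. cinner b b = 1" if "X \<in> \<C>" for X
      using chain that by (auto simp: subset.chain_def F_def)
    ultimately show "\<Union>\<C> \<in> F" unfolding F_def by blast
  qed
  then obtain M where "M \<in> F" and max: "\<And>X. X \<in> F \<Longrightarrow> M \<subseteq> X \<Longrightarrow> X = M" by blast
  have "x = 0" if x: "x \<in> S" "x \<in> orth_compl M" for x
  proof (rule ccontr)
    assume "x \<noteq> 0"
    define u where "u = scaleC (1 / complex_of_real (norm x)) x"
    have "cinner u u = 1"
      using \<open>x \<noteq> 0\<close> by (simp add: u_def cinner_self norm_scaleC norm_divide)
    moreover have "cinner u b = 0" if "b \<in> M" for b
      using x that by (simp add: u_def cinner_scaleC_left orth_compl_def)
    moreover from this have "cinner b u = 0" if "b \<in> M" for b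
      using that cinner_eq_zero_commute by blast
    moreover have "u \<in> S"
      using S x csubspace_scaleC by (auto simp: u_def closed_csubspace_def)
    ultimately have "insert u M \<in> F" "u \<notin> M"
      using \<open>M \<in> F\<close> by (auto simp: F_def)
    then show False using max[of "insert u M"] by blast
  qed
  then show ?thesis
    using \<open>M \<in> F\<close> by (intro exI[of _ M] is_onbI S) (auto simp: F_def)
qed

lemma onb_isometry_image:
  assumes f: "isometry_onto S T f" and T: "closed_csubspace T" and B: "is_onb S B"
  shows "is_onb T (f ` B)"
proof (rule is_onbI[OF T])
  have BS: "B \<subseteq> S" using B by (simp add: is_onb_def)
  note in_S = subsetD[OF BS]
  show "f ` B \<subseteq> T" using BS isometry_onto_image[OF f] by blast
  show "cinner b b = 1" if "b \<in> f ` B" for b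
    using that B by (auto simp: isometry_onto_cinner[OF f] in_S is_onb_def)
  show "cinner b b' = 0" if "b \<in> f ` B" "b' \<in> f ` B" "b \<noteq> b'" for b b'
    using that B by (auto simp: isometry_onto_cinner[OF f] in_S) (auto simp: is_onb_def)
  fix y assume "y \<in> T" "y \<in> orth_compl (f ` B)"
  then obtain x where x: "x \<in> S" "y = f x" using isometry_onto_image[OF f] by blast
  then have "x \<in> orth_compl B"
    using \<open>y \<in> orth_compl (f ` B)\<close> by (auto simp: orth_compl_def isometry_onto_cinner[OF f] in_S)
  then have "x = 0" using onb_orth_compl_zero[OF B] x by blast
  then have "cinner y y = 0"
    using x isometry_onto_cinner[OF f, of x x] by (simp add: cinner.zero_left)
  then show "y = 0" by (simp add: cinner_self_zero_iff)
qed

text \<open>The linear extension of \<open>g\<close> to the span of \<open>B\<close>, as a relation: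
  neither coefficients nor well-definedness have to be discussed, and single-valuedness follows
  later from preservation of inner products.\<close>

inductive_set linear_graph :: "'a::chilbert_space set \<Rightarrow> ('a \<Rightarrow> 'a) \<Rightarrow> ('a \<times> 'a) set"
  for B g where
  base: "b \<in> B \<Longrightarrow> (b, g b) \<in> linear_graph B g"
| zero: "(0, 0) \<in> linear_graph B g"
| add: "(x, y) \<in> linear_graph B g \<Longrightarrow> (x', y') \<in> linear_graph B g \<Longrightarrow>
    (x + x', y + y') \<in> linear_graph B g"
| scaleC: "(x, y) \<in> linear_graph B g \<Longrightarrow> (scaleC c x, scaleC c y) \<in> linear_graph B g"

text \<open>Induction on one pair and, in its base case, on the other: sesquilinearity carries the
  agreement of inner products from generators to the whole graph.\<close>

lemma linear_graph_cinner:
  assumes g: "\<And>a b. a \<in> B \<Longrightarrow> b \<in> B \<Longrightarrow> cinner (g a) (g b) = cinner a b"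
    and "(x, y) \<in> linear_graph B g" "(x', y') \<in> linear_graph B g"
  shows "cinner y y' = cinner x x'"
  using assms(2,3)
proof (induction arbitrary: x' y')
  case (base b)
  show ?case using base(2)
    by induction (auto simp: g base(1) cinner.zero_right cinner_add_right cinner_scaleC_right)
qed (auto simp: cinner.zero_left cinner_add_left cinner_scaleC_left)

lemma Domain_linear_graph: "Domain (linear_graph B g) = cspan B"
proof
  have "x \<in> cspan B" if "(x, y) \<in> linear_graph B g" for x y
    using that cspan_superset[of B] by induction (auto intro: csubspaceD csubspace_cspan)
  then show "Domain (linear_graph B g) \<subseteq> cspan B" by blast
  have "csubspace (Domain (linear_graph B g))"
    unfolding csubspace_def by (blast intro: linear_graph.intros)
  then show "cspan B \<subseteq> Domain (linear_graph B g)"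
    by (rule cspan_minimal) (auto intro: linear_graph.intros)
qed

lemma Range_linear_graph: "Range (linear_graph B g) = cspan (g ` B)"
proof
  have "y \<in> cspan (g ` B)" if "(x, y) \<in> linear_graph B g" for x y
    using that cspan_superset[of "g ` B"] by induction (auto intro: csubspaceD csubspace_cspan)
  then show "Range (linear_graph B g) \<subseteq> cspan (g ` B)" by blast
  have "csubspace (Range (linear_graph B g))"
    unfolding csubspace_def by (blast intro: linear_graph.intros)
  then show "cspan (g ` B) \<subseteq> Range (linear_graph B g)"
    by (rule cspan_minimal) (auto intro: linear_graph.intros)
qed

text \<open>If first coordinates converge to \<open>x\<close>, second coordinates have the same
  mutual distances, so they are Cauchy and converge by completeness.\<close>

lemma isometric_graph_limit:
  fixes G :: "('a::chilbert_space \<times> 'a) set"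
  assumes G: "\<And>x y x' y'. (x, y) \<in> G \<Longrightarrow> (x', y') \<in> G \<Longrightarrow> cinner y y' = cinner x x'"
    and "x \<in> closure (Domain G)"
  shows "\<exists>y. (x, y) \<in> closure G"
proof -
  obtain s where "\<And>n. s n \<in> Domain G" and s: "s \<longlonglongrightarrow> x"
    using assms(2) by (auto simp: closure_sequential)
  then obtain t where st: "\<And>n. (s n, t n) \<in> G"
    unfolding Domain_iff by metis
  have "norm (t m - t n) = norm (s m - s n)" for m n
    by (intro cinner_diff_self_eq G st)
  then have "Cauchy t"
    using LIMSEQ_imp_Cauchy[OF s] by (simp add: Cauchy_def dist_norm)
  then obtain y where "t \<longlonglongrightarrow> y"
    using Cauchy_convergent convergent_def by blast
  then have "(\<lambda>n. (s n, t n)) \<longlonglongrightarrow> (x, y)"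
    using s by (rule tendsto_Pair[rotated])
  then show ?thesis
    using st unfolding closure_sequential by (intro exI[of _ y] exI[of _ "\<lambda>n. (s n, t n)"]) auto
qed

text \<open>The isometry is obtained from its graph, the closure of the span of the pairs
  $(b, g b)$. Since this graph is symmetric in domain and range, surjectivity comes from the
  same completeness argument as totality.\<close>

theorem isometry_extension:
  fixes g :: "'a::chilbert_space \<Rightarrow> 'a"
  assumes g: "\<And>a b. a \<in> B \<Longrightarrow> b \<in> B \<Longrightarrow> cinner (g a) (g b) = cinner a b"
  shows "\<exists>f. isometry_onto (closure (cspan B)) (closure (cspan (g ` B))) f"
proof -
  define G where "G = linear_graph B g"
  have G: "cinner y y' = cinner x x'" if "(x, y) \<in> G" "(x', y') \<in> G" for x y x' y'
    using linear_graph_cinner[OF g] that by (simp add: G_def)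
  have lim: "\<exists>s t. (\<forall>n. (s n, t n) \<in> G) \<and> s \<longlonglongrightarrow> x \<and> t \<longlonglongrightarrow> y"
    if xy: "(x, y) \<in> closure G" for x y
  proof -
    obtain p where p: "\<And>n. p n \<in> G" "p \<longlonglongrightarrow> (x, y)"
      using xy by (auto simp: closure_sequential)
    then show ?thesis
      using tendsto_fst[OF p(2)] tendsto_snd[OF p(2)]
      by (intro exI[of _ "\<lambda>n. fst (p n)"] exI[of _ "\<lambda>n. snd (p n)"]) simp
  qed
  have clI: "(x, y) \<in> closure G" if "\<And>n. (s n, t n) \<in> G" "s \<longlonglongrightarrow> x" "t \<longlonglongrightarrow> y" for s t x y
    unfolding closure_sequential using that by (intro exI[of _ "\<lambda>n. (s n, t n)"]) (simp add: tendsto_Pair)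
  have cinner_cl: "cinner y y' = cinner x x'"
    if xy: "(x, y) \<in> closure G" "(x', y') \<in> closure G" for x y x' y'
  proof -
    obtain s t s' t' where "\<And>n. (s n, t n) \<in> G" "\<And>n. (s' n, t' n) \<in> G"
      and *: "s \<longlonglongrightarrow> x" "t \<longlonglongrightarrow> y" "s' \<longlonglongrightarrow> x'" "t' \<longlonglongrightarrow> y'"
      using lim[OF xy(1)] lim[OF xy(2)] by blast
    then have eq: "(\<lambda>n. cinner (t n) (t' n)) = (\<lambda>n. cinner (s n) (s' n))"
      using G by blast
    show ?thesis
      using cinner.tendsto[OF *(1,3)] cinner.tendsto[OF *(2,4)] LIMSEQ_unique unfolding eq by blast
  qed
  have add_cl: "(x + x', y + y') \<in> closure G"
    if xy: "(x, y) \<in> closure G" "(x', y') \<in> closure G" for x y x' y'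
  proof -
    obtain s t s' t' where "\<And>n. (s n, t n) \<in> G" "\<And>n. (s' n, t' n) \<in> G"
      and *: "s \<longlonglongrightarrow> x" "t \<longlonglongrightarrow> y" "s' \<longlonglongrightarrow> x'" "t' \<longlonglongrightarrow> y'"
      using lim[OF xy(1)] lim[OF xy(2)] by blast
    then show ?thesis
      by (intro clI[of "\<lambda>n. s n + s' n" "\<lambda>n. t n + t' n"] tendsto_add)
        (auto simp: G_def intro: linear_graph.intros)
  qed
  have scaleC_cl: "(scaleC c x, scaleC c y) \<in> closure G" if xy: "(x, y) \<in> closure G" for c x y
  proof -
    obtain s t where "\<And>n. (s n, t n) \<in> G" and *: "s \<longlonglongrightarrow> x" "t \<longlonglongrightarrow> y"
      using lim[OF xy] by blast
    then show ?thesis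
      by (intro clI[of "\<lambda>n. scaleC c (s n)" "\<lambda>n. scaleC c (t n)"] scaleC.tendsto tendsto_const)
        (auto simp: G_def intro: linear_graph.intros)
  qed
  have total: "\<exists>y. (x, y) \<in> closure G" if "x \<in> closure (cspan B)" for x
    using isometric_graph_limit[of G x] G that Domain_linear_graph[of B g] by (auto simp: G_def)
  have onto: "\<exists>x. (x, y) \<in> closure G" if "y \<in> closure (cspan (g ` B))" for y
  proof -
    have "\<exists>x. (y, x) \<in> closure (G\<inverse>)"
      using that Range_linear_graph[of B g]
      by (intro isometric_graph_limit) (auto simp: G_def[symmetric] dest: G)
    then obtain x p where "\<And>n. p n \<in> G\<inverse>" and p: "p \<longlonglongrightarrow> (y, x)"
      by (auto simp: closure_sequential)
    then have "(snd (p n), fst (p n)) \<in> G" for n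
      by (metis converse_iff prod.collapse)
    then have "(x, y) \<in> closure G"
      using tendsto_fst[OF p] tendsto_snd[OF p] by (intro clI) auto
    then show ?thesis ..
  qed
  have unique: "y = y'" if "(x, y) \<in> closure G" "(x, y') \<in> closure G" for x y y'
  proof -
    have "norm (y - y') = norm (x - x)"
      by (intro cinner_diff_self_eq cinner_cl that)
    then show ?thesis by simp
  qed
  have dom: "x \<in> closure (cspan B)" "y \<in> closure (cspan (g ` B))" if xy: "(x, y) \<in> closure G" for x y
  proof -
    obtain s t where "\<And>n. (s n, t n) \<in> G" and "s \<longlonglongrightarrow> x" "t \<longlonglongrightarrow> y"
      using lim[OF xy] by blast
    moreover from this have "s n \<in> cspan B" "t n \<in> cspan (g ` B)" for n
      unfolding Domain_linear_graph[of B g, symmetric] Range_linear_graph[of B g, symmetric]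
      by (auto simp: G_def)
    ultimately show "x \<in> closure (cspan B)" "y \<in> closure (cspan (g ` B))"
      unfolding closure_sequential by blast+
  qed
  define f where "f x = (SOME y. (x, y) \<in> closure G)" for x
  have f: "(x, f x) \<in> closure G" if "x \<in> closure (cspan B)" for x
    unfolding f_def using total[OF that] by (rule someI_ex)
  \<comment> \<open>Membership in the closed graph characterizes \<open>f\<close> on its domain, so
    linearity reduces to the closed graph being closed under sums and scalar multiples.\<close>
  have f_eq: "f x = y" if xy: "(x, y) \<in> closure G" for x y
    using f dom(1) unique that by blast
  have "isometry_onto (closure (cspan B)) (closure (cspan (g ` B))) f"
    unfolding isometry_onto_def
  proof (intro conjI ballI allI)
    show "f ` closure (cspan B) = closure (cspan (g ` B))"
    proof
      show "f ` closure (cspan B) \<subseteq> closure (cspan (g ` B))"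
        using f dom(2) by blast
      show "closure (cspan (g ` B)) \<subseteq> f ` closure (cspan B)"
        using onto dom(1) f_eq by (metis (no_types) imageI subsetI)
    qed
  qed (auto intro!: f_eq cinner_cl add_cl scaleC_cl f)
  then show ?thesis by blast
qed

text \<open>A bijection of orthonormal bases preserves inner products and so extends to an isometry
  of the closed spans; conversely an isometry carries a basis injectively to a basis. This converts
  \<open>same_rank\<close> into a statement about isometries.\<close>

lemma equipollent_onb_iff_isometry:
  assumes S: "closed_csubspace S" and T: "closed_csubspace T"
  shows "(\<exists>A B. is_onb T A \<and> is_onb S B \<and> A \<approx> B) \<longleftrightarrow> (\<exists>f. isometry_onto S T f)"
proof
  assume "\<exists>A B. is_onb T A \<and> is_onb S B \<and> A \<approx> B"
  then obtain A B where A: "is_onb T A" and B: "is_onb S B" and "B \<approx> A"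
    using eqpoll_sym by blast
  then obtain g where g: "inj_on g B" "g ` B = A"
    by (auto simp: eqpoll_def bij_betw_def)
  have "cinner (g a) (g b) = cinner a b" if "a \<in> B" "b \<in> B" for a b
  proof (cases "a = b")
    case False
    then have "g a \<noteq> g b" using inj_onD[OF g(1)] that by blast
    then have "cinner (g a) (g b) = 0" "cinner a b = 0"
      using A B that False unfolding g(2)[symmetric] is_onb_def by auto
    then show ?thesis by simp
  qed (use A B that in \<open>auto simp: g(2)[symmetric] is_onb_def\<close>)
  then obtain f where "isometry_onto (closure (cspan B)) (closure (cspan (g ` B))) f"
    using isometry_extension by blast
  then show "\<exists>f. isometry_onto S T f"
    using A B g by (auto simp: is_onb_def)
next
  assume "\<exists>f. isometry_onto S T f"
  then obtain f where f: "isometry_onto S T f" ..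
  obtain B where B: "is_onb S B" using onb_exists[OF S] ..
  then have "inj_on f B"
    using isometry_onto_inj_on[OF f] inj_on_subset by (auto simp: is_onb_def)
  then have "f ` B \<approx> B" by (rule inj_on_image_eqpoll_self)
  then show "\<exists>A B. is_onb T A \<and> is_onb S B \<and> A \<approx> B"
    using onb_isometry_image[OF f T B] B by blast
qed

subsection \<open>Extending finite partial isometries\<close>

text \<open>The unitary is the rank-one perturbation $x \mapsto x - \frac{\langle v, x\rangle}{\langle v, c\rangle} v$
  of the identity with $v = c - b$, a reflection when $\langle b, c\rangle$ is real.\<close>

lemma rank_one_unitary_exists:
  fixes b c :: "'a::chilbert_space"
  assumes K: "csubspace K" and "b \<in> K" "c \<in> K" and norms: "cinner b b = cinner c c"
  shows "\<exists>W. isometry_onto K K W \<and> W c = b \<and> (\<forall>x. cinner (c - b) x = 0 \<longrightarrow> W x = x)"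
proof (cases "c = b")
  case True
  then show ?thesis using isometry_onto_id by blast
next
  case False
  define v where "v = c - b"
  define w where "w = cinner v c"
  \<comment> \<open>The scalar is kept as a parameter because two values are needed:
    \<open>W (cnj a)\<close> is the adjoint of \<open>W a\<close> and will supply preimages.\<close>
  define W where "W \<alpha> x = x - scaleC (\<alpha> * cinner v x) v" for \<alpha> x
  have "v \<in> K" unfolding v_def using assms by (intro csubspace_diff)
  \<comment> \<open>Here the equality of norms enters. It makes the real part of \<open>w\<close>
    half the squared norm of \<open>v\<close>, so \<open>w\<close> is nonzero when \<open>b\<close>
    and \<open>c\<close> differ.\<close>
  have vv: "cinner v v = w + cnj w"
    using norms cinner_commute[of b c] by (simp add: w_def v_def cinner.diff_left cinner.diff_right
        cinner_commute[of c c, symmetric])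
  have "cinner v v \<noteq> 0"
    using False by (simp add: v_def cinner_self_zero_iff)
  then have "w \<noteq> 0" using vv by auto
  define a where "a = 1 / w"
  \<comment> \<open>The one scalar identity behind both facts below: its defect is the coefficient
    of the error term in \<open>W_cinner\<close> and in \<open>W_inverse\<close>.\<close>
  have key: "a + cnj a = a * cnj a * cinner v v"
    using \<open>w \<noteq> 0\<close> unfolding vv a_def by (simp add: field_simps)
  have W_cinner: "cinner (W a x) (W a y) = cinner x y" for x y
  proof -
    have "cinner (W a x) (W a y) = cinner x y
        - cinner x v * cinner v y * (a + cnj a - a * cnj a * cinner v v)"
      by (simp add: W_def cinner.diff_left cinner.diff_right cinner_scaleC_left
          cinner_scaleC_right cinner_commute[of v x] algebra_simps)
    then show ?thesis using key by simp
  qed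
  have W_inverse: "W a (W (cnj a) x) = x" for x
  proof -
    have "W a (W (cnj a) x) = x - scaleC (cinner v x * (a + cnj a - a * cnj a * cinner v v)) v"
      by (simp add: W_def cinner.diff_right cinner_scaleC_right algebra_simps scaleC.add_left
          scaleC.diff_left)
    then show ?thesis using key by (simp add: scaleC.zero_left)
  qed
  have W_in: "W \<alpha> x \<in> K" if "x \<in> K" for \<alpha> x
    unfolding W_def using K \<open>v \<in> K\<close> that by (intro csubspace_diff csubspace_scaleC)
  have "W a ` K = K"
    using W_in W_inverse by (metis (no_types, lifting) image_iff subsetI subset_antisym image_subsetI)
  then have "isometry_onto K K (W a)"
    using W_cinner unfolding isometry_onto_def
    by (auto simp: W_def cinner_add_right cinner_scaleC_right algebra_simps scaleC.add_left
        scaleC.diff_right scaleC_scaleC)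
  moreover have "W a c = b"
    using \<open>w \<noteq> 0\<close> by (simp add: W_def a_def w_def[symmetric] scaleC_one) (simp add: v_def)
  moreover have "W a x = x" if "cinner (c - b) x = 0" for x
    using that by (simp add: W_def v_def scaleC.zero_left)
  ultimately show ?thesis by blast
qed

text \<open>Vectors are treated one at a time: if \<open>V\<close> is already right on
  \<open>F\<close>, a rank-one unitary \<open>W\<close> moves \<open>V a\<close> to
  \<open>g a\<close>, and \<open>W\<close> fixes every \<open>g f\<close> because
  \<open>V a - g a\<close> is orthogonal to it.\<close>

theorem finite_partial_isometry_extends:
  fixes K :: "'a::chilbert_space set"
  assumes "finite F" and K: "csubspace K" and "F \<subseteq> K" "g ` F \<subseteq> K"
    and "\<And>a b. a \<in> F \<Longrightarrow> b \<in> F \<Longrightarrow> cinner (g a) (g b) = cinner a b"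
  shows "\<exists>V. isometry_onto K K V \<and> (\<forall>a\<in>F. V a = g a)"
  using assms(1,3-)
proof (induction F)
  case empty
  then show ?case using isometry_onto_id by blast
next
  case (insert a F)
  then obtain V where V: "isometry_onto K K V" and VF: "\<And>f. f \<in> F \<Longrightarrow> V f = g f"
    by (metis image_insert insert_iff insert_subset)
  have "a \<in> K" "g a \<in> K" using insert.prems by auto
  obtain W where W: "isometry_onto K K W" "W (V a) = g a"
    and W_fix: "\<And>x. cinner (V a - g a) x = 0 \<Longrightarrow> W x = x"
    using rank_one_unitary_exists[OF K \<open>g a \<in> K\<close> isometry_onto_in[OF V \<open>a \<in> K\<close>]]
      insert.prems(3) isometry_onto_cinner[OF V \<open>a \<in> K\<close> \<open>a \<in> K\<close>] by auto
  have "W (V f) = g f" if "f \<in> F" for f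
  proof -
    have "f \<in> K" using insert.prems that by auto
    \<comment> \<open>Both terms equal \<open>cinner a f\<close>: the first since
      \<open>g f = V f\<close> and \<open>V\<close> is isometric, the second by the assumption on
      \<open>g\<close>.\<close>
    have "cinner (V a - g a) (g f) = cinner (V a) (V f) - cinner (g a) (g f)"
      using VF[OF that] by (simp add: cinner.diff_left)
    also have "\<dots> = 0"
      using insert.prems(3) that isometry_onto_cinner[OF V \<open>a \<in> K\<close> \<open>f \<in> K\<close>] by simp
    finally show ?thesis using VF[OF that] W_fix by simp
  qed
  then show ?case
    using W(2) isometry_onto_compose[OF V W(1)] by (intro exI[of _ "\<lambda>x. W (V x)"]) auto
qed

text \<open>The set where both maps agree is a subspace. The algebraic span suffices because
  \<open>fin_dim\<close> is defined by \<open>cspan\<close> without closure.\<close>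

lemma isometry_onto_eq_on_cspan:
  assumes f: "isometry_onto S T f" "csubspace S" and g: "isometry_onto S' T' g" "csubspace S'"
    and "B \<subseteq> S" "B \<subseteq> S'" "\<And>b. b \<in> B \<Longrightarrow> f b = g b" and "x \<in> cspan B"
  shows "f x = g x"
proof -
  have "csubspace {x \<in> S \<inter> S'. f x = g x}"
    unfolding csubspace_def
    by (auto simp: csubspaceD f(2) g(2) isometry_onto_zero[OF f] isometry_onto_zero[OF g]
        isometry_ontoD[OF f(1)] isometry_ontoD[OF g(1)])
  then show ?thesis
    using cspan_minimal[of "{x \<in> S \<inter> S'. f x = g x}" B] assms(5-) by blast
qed

subsection \<open>Overlapping factorizations\<close>

locale orth_decomposition =
  fixes L C R :: "'a::chilbert_space set"
  assumes decomp: "orth_decomp3 L C R"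
begin

lemma closed [simp]: "closed_csubspace L" "closed_csubspace C" "closed_csubspace R"
  and orth: "corthogonal L C" "corthogonal L R" "corthogonal C R"
  and span: "osum (osum L C) R = UNIV"
  using decomp by (auto simp: orth_decomp3_def)

lemma csubspace_summands: "csubspace L" "csubspace C" "csubspace R"
  using closed by (simp_all add: closed_csubspace_def)

lemma proj_zero:
  "x \<in> L \<Longrightarrow> proj C x = 0" "x \<in> L \<Longrightarrow> proj R x = 0"
  "x \<in> C \<Longrightarrow> proj L x = 0" "x \<in> C \<Longrightarrow> proj R x = 0"
  "x \<in> R \<Longrightarrow> proj L x = 0" "x \<in> R \<Longrightarrow> proj C x = 0"
  using corthogonal_imp[OF orth(1)] corthogonal_imp[OF orth(2)] corthogonal_imp[OF orth(3)]
  by (auto intro: proj_orth_compl)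

lemmas proj_simps = proj_add proj_scaleC proj_id proj_zero proj_in

lemma decompose: "x = proj L x + proj C x + proj R x"
proof -
  obtain l c r where "l \<in> L" "c \<in> C" "r \<in> R" "x = l + c + r"
    using span UNIV_I[of x] unfolding osum_def by blast
  then show ?thesis by (simp add: proj_simps)
qed

text \<open>Writing the sum as a complement makes it closed at once and turns membership into the
  vanishing of the projection onto \<open>R\<close>.\<close>

lemma LC_eq: "osum L C = orth_compl R"
proof
  show "osum L C \<subseteq> orth_compl R"
    using orth by (auto simp: osum_def orth_compl_def corthogonal_def cinner_add_left)
  show "orth_compl R \<subseteq> osum L C"
  proof
    fix x assume "x \<in> orth_compl R"
    then have "x = proj L x + proj C x"
      using decompose[of x] by (simp add: proj_orth_compl)
    then show "x \<in> osum L C" using proj_in closed unfolding osum_def by blast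
  qed
qed

lemma CR_eq: "osum C R = orth_compl L"
proof
  show "osum C R \<subseteq> orth_compl L"
    using corthogonal_imp(2)[OF orth(1)] corthogonal_imp(2)[OF orth(2)]
    by (auto simp: osum_def orth_compl_def cinner_add_left subset_eq)
  show "orth_compl L \<subseteq> osum C R"
  proof
    fix x assume "x \<in> orth_compl L"
    then have "x = proj C x + proj R x"
      using decompose[of x] by (simp add: proj_orth_compl)
    then show "x \<in> osum C R" using proj_in closed unfolding osum_def by blast
  qed
qed

lemma closed_LC [simp]: "closed_csubspace (osum L C)"
  and closed_CR [simp]: "closed_csubspace (osum C R)"
  by (simp_all add: LC_eq CR_eq closed_csubspace_orth_compl)

lemma csubspace_LC: "csubspace (osum L C)" and csubspace_CR: "csubspace (osum C R)"
  using closed_LC closed_CR by (simp_all add: closed_csubspace_def)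

lemma orth_LC_R: "corthogonal (osum L C) R" and orth_L_CR: "corthogonal L (osum C R)"
  using cinner_eq_zero_commute by (auto simp: corthogonal_def LC_eq CR_eq orth_compl_def)

lemma span': "osum L (osum C R) = UNIV"
  using span by (simp add: osum_def set_eq_iff) (metis add.assoc)

lemma in_LC_iff: "x \<in> osum L C \<longleftrightarrow> proj R x = 0"
  and in_CR_iff: "x \<in> osum C R \<longleftrightarrow> proj L x = 0"
  using proj_orth[of R x] proj_orth[of L x] proj_orth_compl[of R x] proj_orth_compl[of L x]
  by (auto simp: LC_eq CR_eq)

lemma subsets_LC_CR: "L \<subseteq> osum L C" "C \<subseteq> osum L C" "C \<subseteq> osum C R" "R \<subseteq> osum C R"
  by (auto simp: in_LC_iff in_CR_iff proj_simps)

lemma proj_LC: "proj (osum L C) x = proj L x + proj C x"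
proof (rule proj_eqI)
  show "x - (proj L x + proj C x) \<in> orth_compl (osum L C)"
    using decompose[of x] corthogonal_imp(2)[OF orth_LC_R] proj_in[of R x]
    by (metis add_diff_cancel_left' closed(3) subsetD)
qed (simp_all add: csubspace_LC in_LC_iff proj_simps)

lemma proj_CR: "proj (osum C R) x = proj C x + proj R x"
proof (rule proj_eqI)
  have "x - (proj C x + proj R x) = proj L x"
    using decompose[of x] by (metis add.assoc add_diff_cancel_right')
  then show "x - (proj C x + proj R x) \<in> orth_compl (osum C R)"
    using corthogonal_imp(1)[OF orth_L_CR] proj_in[of L x] by auto
qed (simp_all add: csubspace_CR in_CR_iff proj_simps)

lemma in_LC_eq: "x \<in> osum L C \<Longrightarrow> x = proj L x + proj C x"
  using decompose[of x] by (simp add: in_LC_iff)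

lemma in_CR_eq: "x \<in> osum C R \<Longrightarrow> x = proj C x + proj R x"
  using decompose[of x] by (simp add: in_CR_iff)

section \<open>Reduction of factorizations to their left factor\<close>

lemma overlap_fact_iff:
  "overlap_fact L C R U X Y \<longleftrightarrow>
     isometry_onto (osum L C) (osum L C) X \<and> isometry_onto (osum C R) (osum C R) Y \<and>
     (\<forall>x. U x = X (proj L x + proj C (Y (proj (osum C R) x))) + proj R (Y (proj (osum C R) x)))"
proof -
  \<comment> \<open>\<open>Y\<close> takes values in \<open>osum C R\<close>, so its value has no
    \<open>L\<close> component and meets the left factor only through \<open>C\<close>.\<close>
  have "proj (osum L C) (proj L x + Y (proj (osum C R) x))
      = proj L x + proj C (Y (proj (osum C R) x))"
    "proj R (proj L x + Y (proj (osum C R) x)) = proj R (Y (proj (osum C R) x))"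
    if "isometry_onto (osum C R) (osum C R) Y" for x
    using isometry_onto_in[OF that proj_in[OF closed_CR, of x]]
    by (simp_all add: proj_LC proj_simps in_CR_iff)
  then show ?thesis
    unfolding overlap_fact_def unitary_on_iff by (auto simp: fun_eq_iff)
qed

lemma overlap_fact_on_L:
  assumes "overlap_fact L C R U X Y" "x \<in> L"
  shows "U x = X x"
proof -
  have "Y 0 = 0"
    using assms(1) isometry_onto_zero[OF _ csubspace_CR] unfolding overlap_fact_iff by blast
  \<comment> \<open>\<open>proj_scaleC\<close> at scalar 0 and vector 0 states that the projections
    vanish at 0.\<close>
  then show ?thesis
    using assms proj_scaleC[of C 0 0] proj_scaleC[of R 0 0]
    unfolding overlap_fact_iff by (simp add: proj_CR proj_simps scaleC.zero_left)
qed

text \<open>$U_{LC}$ determines the factorization: $(U_{LC} \oplus 1)^{-1} U$ fixes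
  $\mathscr{H}_L$ and hence preserves its orthogonal complement $\mathscr{H}_{CR}$.\<close>

lemma overlap_fact_exists_iff:
  assumes U: "isometry_onto UNIV UNIV U"
  shows "(\<exists>X Y. overlap_fact L C R U X Y) \<longleftrightarrow>
    (\<exists>V. isometry_onto (osum L C) (osum L C) V \<and> (\<forall>x\<in>L. V x = U x))"
proof
  assume "\<exists>X Y. overlap_fact L C R U X Y"
  then obtain X Y where XY: "overlap_fact L C R U X Y" by blast
  then show "\<exists>V. isometry_onto (osum L C) (osum L C) V \<and> (\<forall>x\<in>L. V x = U x)"
    using overlap_fact_on_L[OF XY] by (auto simp: overlap_fact_iff)
next
  assume "\<exists>V. isometry_onto (osum L C) (osum L C) V \<and> (\<forall>x\<in>L. V x = U x)"
  then obtain V where V: "isometry_onto (osum L C) (osum L C) V" and VU: "\<And>x. x \<in> L \<Longrightarrow> V x = U x"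
    by blast
  define A where "A x = V (proj (osum L C) x) + proj R x" for x
  have A: "isometry_onto UNIV UNIV A"
    using isometry_onto_osum[OF closed_LC closed(3) orth_LC_R orth_LC_R V isometry_onto_id]
    unfolding span A_def[abs_def] .
  define B where "B x = inv A (U x)" for x
  have B: "isometry_onto UNIV UNIV B"
    unfolding B_def[abs_def]
    by (rule isometry_onto_compose[OF U isometry_onto_inv_into[OF A csubspace_UNIV]])
  have AB: "A (B x) = U x" for x
    using isometry_onto_image[OF A] by (simp add: B_def f_inv_into_f)
  have BL: "B x = x" if "x \<in> L" for x
  proof -
    have "A x = U x"
      using that by (simp add: A_def proj_LC proj_simps VU)
    then show ?thesis
      using isometry_onto_inj_on[OF A] by (metis B_def inv_f_f)
  qed
  then have "B ` L = L" by auto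
  then have BCR: "isometry_onto (osum C R) (osum C R) B"
    using isometry_onto_orth_compl[OF B, of L L] by (simp add: CR_eq)
  have "U x = V (proj L x + proj C (B (proj (osum C R) x))) + proj R (B (proj (osum C R) x))" for x
  proof -
    have "x = proj L x + proj (osum C R) x"
      using decompose[of x] by (simp add: proj_CR add.assoc)
    then have "B x = proj L x + B (proj (osum C R) x)"
      using isometry_onto_add[OF B UNIV_I UNIV_I] BL[OF proj_in[OF closed(1)]] by metis
    then show ?thesis
      using isometry_onto_in[OF BCR proj_in[OF closed_CR, of x]]
      by (simp add: AB[of x, symmetric] A_def proj_LC proj_simps in_CR_iff)
  qed
  then have "overlap_fact L C R U V B"
    using V BCR by (simp add: overlap_fact_iff)
  then show "\<exists>X Y. overlap_fact L C R U X Y" by blast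
qed

text \<open>A unitary of \<open>osum L C\<close> agreeing with \<open>U\<close> on \<open>L\<close>
  carries the complement \<open>C\<close> of \<open>L\<close> onto the complement of
  \<open>U L\<close>; conversely \<open>U\<close> on \<open>L\<close> and \<open>J\<close> on
  \<open>C\<close> are glued along the orthogonal sum.\<close>

lemma overlap_fact_exists_iff_isometry:
  assumes U: "isometry_onto UNIV UNIV U"
  shows "(\<exists>X Y. overlap_fact L C R U X Y) \<longleftrightarrow>
    U ` L \<subseteq> osum L C \<and> (\<exists>J. isometry_onto C (osum L C \<inter> orth_compl (U ` L)) J)"
    (is "_ \<longleftrightarrow> _ \<and> (\<exists>J. isometry_onto C ?M J)")
  unfolding overlap_fact_exists_iff[OF U]
proof (intro iffI conjI)
  assume "\<exists>V. isometry_onto (osum L C) (osum L C) V \<and> (\<forall>x\<in>L. V x = U x)"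
  then obtain V where V: "isometry_onto (osum L C) (osum L C) V" and VU: "\<And>x. x \<in> L \<Longrightarrow> V x = U x"
    by blast
  note sub = subsetD[OF subsets_LC_CR(1)] subsetD[OF subsets_LC_CR(2)]
  show "U ` L \<subseteq> osum L C"
    using VU isometry_onto_in[OF V] sub(1) by (metis image_subsetI)
  have "V ` C = ?M"
  proof
    have "cinner (V x) (V y) = 0" if "x \<in> C" "y \<in> L" for x y
      using that orth(1) cinner_eq_zero_commute[of x y]
      by (auto simp: isometry_onto_cinner[OF V] sub corthogonal_def)
    then show "V ` C \<subseteq> ?M"
      using isometry_onto_in[OF V sub(2)] VU by (auto simp: orth_compl_def)
    show "?M \<subseteq> V ` C"
    proof
      fix m assume m: "m \<in> ?M"
      then obtain z where z: "z \<in> osum L C" "m = V z"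
        using isometry_onto_image[OF V] by blast
      have "cinner z y = 0" if "y \<in> L" for y
        using m that isometry_onto_cinner[OF V z(1) sub(1)[OF that]] VU[OF that]
        by (simp add: z(2) orth_compl_def)
      then have "z = proj C z"
        using in_LC_eq[OF z(1)] proj_orth_compl[of L z] by (simp add: orth_compl_def)
      then show "m \<in> V ` C"
        using z(2) proj_in[of C z] by (metis closed(2) imageI)
    qed
  qed
  then show "\<exists>J. isometry_onto C ?M J"
    using isometry_onto_subset[OF V subsets_LC_CR(2)] by auto
next
  assume "U ` L \<subseteq> osum L C \<and> (\<exists>J. isometry_onto C ?M J)"
  then obtain J where UL: "U ` L \<subseteq> osum L C" and J: "isometry_onto C ?M J" by blast
  note LC = csubspace_LC
  define V where "V x = U (proj L x) + J (proj C x)" for x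
  have "corthogonal (U ` L) ?M"
    using cinner_eq_zero_commute by (auto simp: corthogonal_def orth_compl_def)
  then have V: "isometry_onto (osum L C) (osum (U ` L) ?M) V"
    unfolding V_def[abs_def]
    by (intro isometry_onto_osum closed orth(1) J isometry_onto_subset[OF U]) auto
  have "osum (U ` L) ?M = osum L C"
  proof
    show "osum (U ` L) ?M \<subseteq> osum L C"
      using UL csubspace_add[OF LC] by (auto simp: osum_def[of "U ` L"])
    show "osum L C \<subseteq> osum (U ` L) ?M"
    proof
      fix x assume x: "x \<in> osum L C"
      \<comment> \<open>Pulling \<open>x\<close> back through \<open>U\<close> splits it along
        \<open>U L\<close>: the \<open>L\<close> part of \<open>y\<close> maps into
        \<open>U L\<close>, the rest to a vector orthogonal to \<open>U L\<close>, which lies in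
        \<open>osum L C\<close> as a difference of two vectors there.\<close>
      obtain y where y: "x = U y" using isometry_onto_image[OF U] by blast
      have "y = proj L y + (proj C y + proj R y)"
        using decompose[of y] by (simp add: add.assoc)
      then have "x = U (proj L y) + U (proj C y + proj R y)"
        using isometry_onto_add[OF U UNIV_I UNIV_I] y by metis
      moreover have UL': "U (proj L y) \<in> U ` L"
        using proj_in[of L y] by simp
      moreover have "U (proj C y + proj R y) \<in> osum L C"
        using csubspace_diff[OF LC x subsetD[OF UL UL']] calculation(1) by simp
      moreover have "proj C y + proj R y \<in> orth_compl L"
        unfolding proj_CR[symmetric] CR_eq[symmetric] by (rule proj_in[OF closed_CR])
      then have "U (proj C y + proj R y) \<in> orth_compl (U ` L)"
        by (simp add: orth_compl_def isometry_onto_cinner[OF U])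
      ultimately show "x \<in> osum (U ` L) ?M"
        unfolding osum_def[of "U ` L"] by blast
    qed
  qed
  moreover have "V x = U x" if "x \<in> L" for x
    using that isometry_onto_zero[OF J csubspace_summands(2)] by (simp add: V_def proj_simps)
  ultimately show "\<exists>V. isometry_onto (osum L C) (osum L C) V \<and> (\<forall>x\<in>L. V x = U x)"
    using V by auto
qed

section \<open>The rank condition\<close>

lemma image_L_subset_iff:
  "U ` L \<subseteq> osum L C \<longleftrightarrow> (\<forall>x. proj R (U (proj L x)) = 0)"
proof -
  have "range (proj L) = L"
    using proj_in[OF closed(1)] proj_id[OF closed(1)] by (metis image_subsetI subsetI subset_antisym rangeI)
  then show ?thesis
    unfolding in_LC_iff subset_eq by (metis imageE imageI rangeI)
qed

text \<open>\<open>U\<close> maps \<open>osum C R\<close>, the complement of \<open>L\<close>, onto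
  the complement of \<open>U L\<close>. Projecting to \<open>osum L C\<close> keeps vectors
  orthogonal to \<open>U L\<close>, as the removed part is orthogonal to all of
  \<open>osum L C\<close>; and on preimages of vectors of \<open>?M\<close> both projections act
  trivially. Hence the range is already closed.\<close>

lemma closure_range_corner:
  assumes U: "isometry_onto UNIV UNIV U" and UL: "U ` L \<subseteq> osum L C"
  shows "closure (range (\<lambda>x. proj (osum L C) (U (proj (osum C R) x))))
    = osum L C \<inter> orth_compl (U ` L)" (is "closure (range ?T) = ?M")
proof -
  have "?T x \<in> orth_compl (U ` L)" for x
    unfolding orth_compl_def
  proof (intro CollectI ballI)
    fix z assume "z \<in> U ` L"
    then obtain l where l: "l \<in> L" "z = U l" by blast
    let ?u = "U (proj (osum C R) x)"
    have "cinner ?u z = cinner (proj (osum C R) x) l"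
      by (simp add: l isometry_onto_cinner[OF U])
    also have "\<dots> = 0"
      using proj_in[OF closed_CR, of x] l by (simp add: CR_eq orth_compl_def)
    finally have "cinner ?u z = 0" .
    moreover have "cinner (?u - ?T x) z = 0"
      using proj_orth[OF closed_LC, of ?u] UL \<open>z \<in> U ` L\<close> by (auto simp: orth_compl_def)
    ultimately show "cinner (?T x) z = 0" by (simp add: cinner.diff_left)
  qed
  then have "range ?T \<subseteq> ?M" using proj_in[OF closed_LC] by blast
  moreover have "?M \<subseteq> range ?T"
  proof
    fix m assume m: "m \<in> ?M"
    obtain y where y: "m = U y" using isometry_onto_image[OF U] by blast
    have "y \<in> osum C R"
      using m y by (simp add: CR_eq orth_compl_def isometry_onto_cinner[OF U])
    then have "m = ?T y"
      using m y by (simp add: proj_id[OF closed_CR] proj_id[OF closed_LC])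
    then show "m \<in> range ?T" by blast
  qed
  ultimately have "range ?T = ?M" by (rule subset_antisym)
  moreover have "closed_csubspace ?M"
    by (intro closed_csubspace_Int closed_LC closed_csubspace_orth_compl)
  ultimately show ?thesis by (simp add: closed_csubspace_def)
qed

lemma closure_range_proj: "closure (range (proj C)) = C"
proof -
  have "range (proj C) = C"
    using proj_in[OF closed(2)] proj_id[OF closed(2)] by (metis image_subsetI subsetI subset_antisym rangeI)
  then show ?thesis using closed(2) by (simp add: closed_csubspace_def)
qed

theorem overlap_fact_exists_iff_rank:
  assumes U: "isometry_onto UNIV UNIV U"
  shows "(\<exists>X Y. overlap_fact L C R U X Y) \<longleftrightarrow>
    (\<forall>x. proj R (U (proj L x)) = 0) \<and>
    same_rank (\<lambda>x. proj (osum L C) (U (proj (osum C R) x))) (proj C)"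
proof -
  have "closed_csubspace (osum L C \<inter> orth_compl (U ` L))"
    by (intro closed_csubspace_Int closed_LC closed_csubspace_orth_compl)
  \<comment> \<open>The range of the corner is identified only under the first condition, so the
    rank equivalence is proved conditionally and then merged into the conjunction.\<close>
  then have "same_rank (\<lambda>x. proj (osum L C) (U (proj (osum C R) x))) (proj C) \<longleftrightarrow>
      (\<exists>J. isometry_onto C (osum L C \<inter> orth_compl (U ` L)) J)" if "U ` L \<subseteq> osum L C"
    unfolding same_rank_def closure_range_corner[OF U that] closure_range_proj
    by (rule equipollent_onb_iff_isometry[OF closed(2)])
  then show ?thesis
    unfolding overlap_fact_exists_iff_isometry[OF U] image_L_subset_iff[symmetric] by blast
qed

text \<open>Either \<open>U\<close> on a finite spanning set of \<open>L\<close> is extended inside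
  \<open>osum L C\<close>, or the inverse of \<open>U\<close> on one of \<open>R\<close> is extended
  inside \<open>osum C R\<close>.\<close>

theorem overlap_fact_exists_of_fin_dim:
  assumes U: "isometry_onto UNIV UNIV U" and fin: "fin_dim L \<or> fin_dim R"
    and UL: "U ` L \<subseteq> osum L C"
  shows "\<exists>X Y. overlap_fact L C R U X Y"
  using fin
proof
  note LC = csubspace_LC
  assume "fin_dim L"
  then obtain F where F: "finite F" "L = cspan F" by (auto simp: fin_dim_def)
  then have FL: "F \<subseteq> L" using cspan_superset by blast
  have "F \<subseteq> osum L C" "U ` F \<subseteq> osum L C" using FL UL subsets_LC_CR by blast+
  then obtain V where V: "isometry_onto (osum L C) (osum L C) V" "\<forall>a\<in>F. V a = U a"
    using finite_partial_isometry_extends[OF F(1) LC, of U] isometry_onto_cinner[OF U] by blast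
  have "V x = U x" if "x \<in> L" for x
    by (rule isometry_onto_eq_on_cspan[OF V(1) LC U csubspace_UNIV \<open>F \<subseteq> osum L C\<close> subset_UNIV])
      (use V(2) that F(2) in blast)+
  then show ?thesis using V(1) overlap_fact_exists_iff[OF U] by blast
next
  note CR = csubspace_CR
  assume "fin_dim R"
  then obtain F where F: "finite F" "R = cspan F" by (auto simp: fin_dim_def)
  then have FR: "F \<subseteq> R" using cspan_superset by blast
  define U' where "U' = inv U"
  have U': "isometry_onto UNIV UNIV U'"
    unfolding U'_def by (rule isometry_onto_inv_into[OF U csubspace_UNIV])
  have UU': "U (U' x) = x" for x
    using isometry_onto_image[OF U] by (simp add: U'_def f_inv_into_f)
  \<comment> \<open>The inner product of \<open>U' x\<close> with \<open>l\<close> equals that of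
    \<open>x\<close> with \<open>U l\<close>, and \<open>U l\<close> is orthogonal to
    \<open>R\<close> by hypothesis.\<close>
  have "U' x \<in> osum C R" if "x \<in> R" for x
  proof -
    have "cinner (U' x) l = 0" if "l \<in> L" for l
    proof -
      have "U l \<in> orth_compl R" using UL that LC_eq by blast
      then have "cinner x (U l) = 0"
        using \<open>x \<in> R\<close> cinner_eq_zero_commute by (auto simp: orth_compl_def)
      then show ?thesis using isometry_onto_cinner[OF U, of "U' x" l] by (simp add: UU')
    qed
    then show ?thesis by (simp add: CR_eq orth_compl_def)
  qed
  then have "F \<subseteq> osum C R" "U' ` F \<subseteq> osum C R" using FR subsets_LC_CR by blast+
  then obtain T where T: "isometry_onto (osum C R) (osum C R) T" "\<forall>a\<in>F. T a = U' a"
    using finite_partial_isometry_extends[OF F(1) CR, of U'] isometry_onto_cinner[OF U'] by blast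
  have TR: "T x = U' x" if "x \<in> R" for x
    by (rule isometry_onto_eq_on_cspan[OF T(1) CR U' csubspace_UNIV \<open>F \<subseteq> osum C R\<close> subset_UNIV])
      (use T(2) that F(2) in blast)+
  \<comment> \<open>On \<open>R\<close>, \<open>T\<close> is the inverse of \<open>U\<close>, so
    \<open>V\<close> is the identity there; on \<open>L\<close> the inner map is the identity, so
    \<open>V\<close> agrees with \<open>U\<close>.\<close>
  define V where "V x = U (proj L x + T (proj (osum C R) x))" for x
  have V: "isometry_onto UNIV UNIV V"
    unfolding V_def[abs_def]
    using isometry_onto_compose[OF isometry_onto_osum[OF closed(1) closed_CR orth_L_CR orth_L_CR
          isometry_onto_id T(1)], unfolded span', OF U] .
  have "V x = x" if "x \<in> R" for x
    using that TR UU' by (simp add: V_def proj_CR proj_simps)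
  then have "V ` R = R" by auto
  then have "isometry_onto (osum L C) (osum L C) V"
    using isometry_onto_orth_compl[OF V, of R R] by (simp add: LC_eq)
  moreover have "V x = U x" if "x \<in> L" for x
    using that isometry_onto_zero[OF T(1) CR] by (simp add: V_def proj_CR proj_simps)
  ultimately show ?thesis using overlap_fact_exists_iff[OF U] by blast
qed

text \<open>Two left factors agree with \<open>U\<close> on \<open>L\<close>, so they differ by a
  unitary of \<open>osum L C\<close> fixing \<open>L\<close>, that is, by a unitary of
  \<open>C\<close>; injectivity of the left factor then forces the inverse of that unitary on the
  right.\<close>

theorem overlap_fact_unique:
  assumes fact: "overlap_fact L C R U X Y"
  shows "overlap_fact L C R U X' Y' \<longleftrightarrow>
    (\<exists>Q Q'. unitary_on C Q \<and> is_adjoint_on C Q Q' \<and>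
       (\<forall>x\<in>osum L C. X' x = X (proj L x + Q (proj C x))) \<and>
       (\<forall>x\<in>osum C R. Y' x = Q' (proj C (Y x)) + proj R (Y x)))"
proof
  note LC = csubspace_LC and CR = csubspace_CR and C = csubspace_summands(2)
  have X: "isometry_onto (osum L C) (osum L C) X" and Y: "isometry_onto (osum C R) (osum C R) Y"
    and U: "\<And>x. U x = X (proj L x + proj C (Y (proj (osum C R) x))) + proj R (Y (proj (osum C R) x))"
    using fact by (auto simp: overlap_fact_iff)
  note CLC = subsetD[OF subsets_LC_CR(2)] and LLC = subsetD[OF subsets_LC_CR(1)]
  {
    assume fact': "overlap_fact L C R U X' Y'"
    then have X': "isometry_onto (osum L C) (osum L C) X'" and Y': "isometry_onto (osum C R) (osum C R) Y'"
      and U': "\<And>x. U x = X' (proj L x + proj C (Y' (proj (osum C R) x))) + proj R (Y' (proj (osum C R) x))"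
      by (auto simp: overlap_fact_iff)
    have XX'L: "X x = X' x" if "x \<in> L" for x
      using overlap_fact_on_L[OF fact that] overlap_fact_on_L[OF fact' that] by simp
    \<comment> \<open>The quotient of the two left factors. It fixes \<open>L\<close> pointwise and
      therefore carries \<open>C\<close>, the complement of \<open>L\<close> in
      \<open>osum L C\<close>, onto itself.\<close>
    define P where "P x = inv_into (osum L C) X (X' x)" for x
    have P: "isometry_onto (osum L C) (osum L C) P"
      unfolding P_def[abs_def] by (rule isometry_onto_compose[OF X' isometry_onto_inv_into[OF X LC]])
    have XP: "X (P x) = X' x" if "x \<in> osum L C" for x
      using isometry_onto_in[OF X' that] isometry_onto_image[OF X] by (simp add: P_def f_inv_into_f)
    have PL: "P x = x" if "x \<in> L" for x
      unfolding P_def XX'L[OF that, symmetric]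
      by (rule inv_into_f_f[OF isometry_onto_inj_on[OF X] LLC[OF that]])
    have "P ` C = C"
    proof
      have "P x \<in> C" if "x \<in> C" for x
      proof -
        have "cinner (P x) l = 0" if "l \<in> L" for l
          using isometry_onto_cinner[OF P CLC[OF \<open>x \<in> C\<close>] LLC[OF that]] PL[OF that] that \<open>x \<in> C\<close>
            corthogonal_imp(2)[OF orth(1)] by (auto simp: orth_compl_def)
        then have "P x = proj C (P x)"
          using in_LC_eq[OF isometry_onto_in[OF P CLC[OF that]]] proj_orth_compl[of L "P x"]
          by (simp add: orth_compl_def)
        then show ?thesis using proj_in[of C "P x"] by simp
      qed
      then show "P ` C \<subseteq> C" by blast
      show "C \<subseteq> P ` C"
      proof
        fix c assume "c \<in> C"
        then obtain z where z: "z \<in> osum L C" "c = P z"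
          using isometry_onto_image[OF P] CLC by blast
        have "cinner z l = 0" if "l \<in> L" for l
          using isometry_onto_cinner[OF P z(1) LLC[OF that]] PL[OF that] that \<open>c \<in> C\<close>
            corthogonal_imp(2)[OF orth(1)] by (auto simp: orth_compl_def z(2))
        then have "z = proj C z"
          using in_LC_eq[OF z(1)] proj_orth_compl[of L z] by (simp add: orth_compl_def)
        then show "c \<in> P ` C" using z(2) proj_in[of C z] by (metis closed(2) imageI)
      qed
    qed
    then have PC: "isometry_onto C C P"
      using isometry_onto_subset[OF P subsets_LC_CR(2)] by simp
    define P' where "P' = inv_into C P"
    have P': "isometry_onto C C P'"
      unfolding P'_def by (rule isometry_onto_inv_into[OF PC C])
    have PP': "P (P' x) = x" "P' (P x) = x" if "x \<in> C" for x
      using that isometry_onto_image[OF PC] isometry_onto_inj_on[OF PC]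
      by (auto simp: P'_def f_inv_into_f)
    have "is_adjoint_on C P P'"
      unfolding is_adjoint_on_def
    proof (intro conjI ballI)
      show "P' ` C \<subseteq> C" using isometry_onto_image[OF P'] by simp
      show "cinner (P x) y = cinner x (P' y)" if "x \<in> C" "y \<in> C" for x y
        using isometry_onto_cinner[OF PC that(1) isometry_onto_in[OF P' that(2)]] PP'(1)[OF that(2)]
        by simp
    qed
    moreover have "X' x = X (proj L x + P (proj C x))" if "x \<in> osum L C" for x
    proof -
      have "P x = proj L x + P (proj C x)"
        using isometry_onto_add[OF P LLC[OF proj_in[OF closed(1)]] CLC[OF proj_in[OF closed(2)]], of x x]
          in_LC_eq[OF that] PL[OF proj_in[OF closed(1)]] by simp
      then show ?thesis using XP[OF that] by simp
    qed
    moreover have "Y' x = P' (proj C (Y x)) + proj R (Y x)" if x: "x \<in> osum C R" for x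
    proof -
      let ?c = "proj C (Y x)" and ?c' = "proj C (Y' x)"
      have c: "?c \<in> C" "?c' \<in> C" by (simp_all add: proj_in)
      \<comment> \<open>For \<open>x\<close> in \<open>osum C R\<close> both formulas split
        \<open>U x\<close> into an \<open>osum L C\<close> part and an \<open>R\<close> part; the
        \<open>R\<close> parts are compared first, then cancelled.\<close>
      have U1: "U x = X ?c + proj R (Y x)" and U2: "U x = X' ?c' + proj R (Y' x)"
        using U[of x] U'[of x] x by (simp_all add: proj_id in_CR_iff)
      have "X ?c \<in> osum L C" "X' ?c' \<in> osum L C"
        using isometry_onto_in[OF X CLC] isometry_onto_in[OF X' CLC] c by auto
      then have "proj R (U x) = proj R (Y x)" "proj R (U x) = proj R (Y' x)"
        by (simp add: U1 proj_simps in_LC_iff, simp add: U2 proj_simps in_LC_iff)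
      then have R: "proj R (Y' x) = proj R (Y x)" by simp
      then have "X ?c = X (P ?c')"
        using U1 U2 XP[OF CLC[OF c(2)]] by simp
      then have "?c = P ?c'"
        using inj_onD[OF isometry_onto_inj_on[OF X]] CLC c isometry_onto_in[OF PC] by blast
      then have "?c' = P' ?c" using PP'(2)[OF c(2)] by simp
      then show ?thesis
        using in_CR_eq[OF isometry_onto_in[OF Y' x]] R by simp
    qed
    ultimately show "\<exists>Q Q'. unitary_on C Q \<and> is_adjoint_on C Q Q' \<and>
       (\<forall>x\<in>osum L C. X' x = X (proj L x + Q (proj C x))) \<and>
       (\<forall>x\<in>osum C R. Y' x = Q' (proj C (Y x)) + proj R (Y x))"
      using PC unfolding unitary_on_iff by blast
  }
  {
    assume "\<exists>Q Q'. unitary_on C Q \<and> is_adjoint_on C Q Q' \<and>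
       (\<forall>x\<in>osum L C. X' x = X (proj L x + Q (proj C x))) \<and>
       (\<forall>x\<in>osum C R. Y' x = Q' (proj C (Y x)) + proj R (Y x))"
    then obtain Q Q' where Q: "isometry_onto C C Q" and adj: "is_adjoint_on C Q Q'"
      and X': "\<And>x. x \<in> osum L C \<Longrightarrow> X' x = X (proj L x + Q (proj C x))"
      and Y': "\<And>x. x \<in> osum C R \<Longrightarrow> Y' x = Q' (proj C (Y x)) + proj R (Y x)"
      unfolding unitary_on_iff by blast
    have Q'_in: "Q' x \<in> C" if "x \<in> C" for x
      using adj that by (auto simp: is_adjoint_on_def)
    \<comment> \<open>\<open>Q'\<close> is known only through the adjoint identity; the difference
      \<open>Q' (Q x) - x\<close> lies in \<open>C\<close> and is orthogonal to all of
      \<open>C\<close>, hence to itself.\<close>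
    have Q'Q: "Q' (Q x) = x" if "x \<in> C" for x
    proof -
      have "cinner y (Q' (Q x) - x) = 0" if "y \<in> C" for y
      proof -
        have "cinner y (Q' (Q x)) = cinner (Q y) (Q x)"
          using adj isometry_onto_in[OF Q \<open>x \<in> C\<close>] that by (auto simp: is_adjoint_on_def)
        then show ?thesis
          by (simp add: isometry_onto_cinner[OF Q that \<open>x \<in> C\<close>] cinner.diff_right)
      qed
      then have "cinner (Q' (Q x) - x) (Q' (Q x) - x) = 0"
        using csubspace_diff[OF C Q'_in[OF isometry_onto_in[OF Q that]] that] by blast
      then show ?thesis by (simp add: cinner_self_zero_iff)
    qed
    have QQ': "Q (Q' x) = x" if x: "x \<in> C" for x
    proof -
      obtain y where "y \<in> C" "x = Q y" using x isometry_onto_image[OF Q] by blast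
      then show ?thesis by (simp add: Q'Q)
    qed
    \<comment> \<open>Equality is available on \<open>C\<close> only, values elsewhere being
      arbitrary, so the isometry property is transferred by
      \<open>isometry_onto_cong\<close>.\<close>
    have "Q' x = inv_into C Q x" if "x \<in> C" for x
      using inv_into_f_f[OF isometry_onto_inj_on[OF Q] Q'_in[OF that]] QQ'[OF that] by simp
    then have Q': "isometry_onto C C Q'"
      by (rule isometry_onto_cong[OF isometry_onto_inv_into[OF Q C] C])
    have "isometry_onto (osum L C) (osum L C) (\<lambda>x. proj L x + Q (proj C x))"
      by (rule isometry_onto_osum[OF closed(1,2) orth(1) orth(1) isometry_onto_id Q])
    from isometry_onto_compose[OF this X]
    have X'_iso: "isometry_onto (osum L C) (osum L C) X'"
      by (rule isometry_onto_cong[OF _ LC X'])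
    have "isometry_onto (osum C R) (osum C R) (\<lambda>x. Q' (proj C x) + proj R x)"
      by (rule isometry_onto_osum[OF closed(2,3) orth(3) orth(3) Q' isometry_onto_id])
    from isometry_onto_compose[OF Y this]
    have Y'_iso: "isometry_onto (osum C R) (osum C R) Y'"
      by (rule isometry_onto_cong[OF _ CR Y'])
    have "U x = X' (proj L x + proj C (Y' (proj (osum C R) x))) + proj R (Y' (proj (osum C R) x))" for x
    proof -
      let ?y = "Y (proj (osum C R) x)"
      have y: "Y' (proj (osum C R) x) = Q' (proj C ?y) + proj R ?y"
        by (rule Y'[OF proj_in[OF closed_CR]])
      have Qy: "Q' (proj C ?y) \<in> C" by (intro Q'_in proj_in closed)
      then have "proj L x + Q' (proj C ?y) \<in> osum L C"
        unfolding osum_def[of L C] using proj_in[OF closed(1)] by blast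
      \<comment> \<open>\<open>Q\<close> from the left factor meets \<open>Q'\<close> from the right
        one and cancels it on the shared summand \<open>C\<close>.\<close>
      from X'[OF this] have "X' (proj L x + Q' (proj C ?y)) = X (proj L x + proj C ?y)"
        using Qy by (simp add: proj_simps QQ')
      then show ?thesis
        using U[of x] Qy by (simp add: y proj_simps)
    qed
    then show "overlap_fact L C R U X' Y'"
      using X'_iso Y'_iso by (simp add: overlap_fact_iff)
  }
qed

end

text \<open>Uniqueness is an equivalence so as to cover both that other factorizations arise from
  some \<open>UC\<close> and that every \<open>UC\<close> yields one. Equality of factors is asked
  on \<open>osum L C\<close> and \<open>osum C R\<close> only, since \<open>overlap_fact\<close>
  evaluates them nowhere else.\<close>

theorem theorem2p4:
  fixes L C R :: "'a::chilbert_space set" and U :: "'a \<Rightarrow> 'a"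
  assumes decomp: "orth_decomp3 L C R"
    and unitary: "unitary_on UNIV U"
  shows "((\<exists>ULC UCR. overlap_fact L C R U ULC UCR) \<longleftrightarrow>
            ((\<forall>x. proj R (U (proj L x)) = 0) \<and>
             same_rank (\<lambda>x. proj (osum L C) (U (proj (osum C R) x))) (proj C)))
       \<and> (\<forall>ULC UCR. overlap_fact L C R U ULC UCR \<longrightarrow>
            (\<forall>VLC VCR. overlap_fact L C R U VLC VCR \<longleftrightarrow>
               (\<exists>UC UCadj. unitary_on C UC \<and> is_adjoint_on C UC UCadj \<and>
                  (\<forall>x\<in>osum L C. VLC x = ULC (proj L x + UC (proj C x))) \<and>
                  (\<forall>x\<in>osum C R. VCR x = UCadj (proj C (UCR x)) + proj R (UCR x)))))
       \<and> ((fin_dim L \<or> fin_dim R) \<longrightarrow>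
            ((\<exists>ULC UCR. overlap_fact L C R U ULC UCR) \<longleftrightarrow> (\<forall>x. proj R (U (proj L x)) = 0)))"
proof (intro conjI allI impI)
  interpret orth_decomposition L C R
    by unfold_locales (rule decomp)
  have U: "isometry_onto UNIV UNIV U"
    using unitary by (simp add: unitary_on_iff)
  note rank = overlap_fact_exists_iff_rank[OF U]
  show "(\<exists>ULC UCR. overlap_fact L C R U ULC UCR) \<longleftrightarrow>
            ((\<forall>x. proj R (U (proj L x)) = 0) \<and>
             same_rank (\<lambda>x. proj (osum L C) (U (proj (osum C R) x))) (proj C))"
    by (rule rank)
  show "overlap_fact L C R U VLC VCR \<longleftrightarrow>
               (\<exists>UC UCadj. unitary_on C UC \<and> is_adjoint_on C UC UCadj \<and>
                  (\<forall>x\<in>osum L C. VLC x = ULC (proj L x + UC (proj C x))) \<and>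
                  (\<forall>x\<in>osum C R. VCR x = UCadj (proj C (UCR x)) + proj R (UCR x)))"
    if "overlap_fact L C R U ULC UCR" for ULC UCR VLC VCR
    by (rule overlap_fact_unique[OF that])
  show "(\<exists>ULC UCR. overlap_fact L C R U ULC UCR) \<longleftrightarrow> (\<forall>x. proj R (U (proj L x)) = 0)"
    if "fin_dim L \<or> fin_dim R"
    using rank overlap_fact_exists_of_fin_dim[OF U that] unfolding image_L_subset_iff by blast
qed

end
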